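(* Let $m\ge 1$, let $\mathbf d=(d_1,\dots,d_m)$ be a sequence of positive integers, let $d\ge 1$ be an integer, and let $\mathbf d'=(d_1,\dots,d_m,d)$. Let $\mathrm T_{\mathbf d}$ be a uniformly random element of $\mathcal T_{\mathbf d}$, and, independently of $\mathrm T_{\mathbf d}$, let $W$ be a uniformly random multiset of size $d$ of vertices of $\mathrm T_{\mathbf d}$ (that is, of elements of $[m]\cup\{\ell_1,\dots,\ell_{L_{\mathbf d}}\}$). Let $\mathrm T_{\mathbf d'}$ be the output of the growth procedure applied to $(\mathrm T_{\mathbf d},W)$. Then $\mathrm T_{\mathbf d'}$ is a uniformly random element of $\mathcal T_{\mathbf d'}$.
   Context: Write $[m]=\{1,\dots,m\}$, and fix an abstract set $\{\ell_i : i\ge 1\}$ of distinct leaf labels, disjoint from the integers. For a finite sequence $\mathbf d=(d_1,\dots,d_m)$ of positive integers let $L_{\mathbf d}=1+\sum_{i=1}^m(d_i-1)$. Let $\mathcal T_{\mathbf d}$ be the set of rooted trees (with no planar order on children) with vertex set $[m]\cup\{\ell_1,\dots,\ell_{L_{\mathbf d}}\}$ such that each $i\in[m]$ has exactly $d_i$ children and each $\ell_i$ is a leaf (has no children). For $\mathbf d'=(d_1,\dots,d_m,d)$ we have $L_{\mathbf d'}=L_{\mathbf d}+d-1$, and elements of $\mathcal T_{\mathbf d'}$ have vertex set $[m+1]\cup\{\ell_1,\dots,\ell_{L_{\mathbf d'}}\}$. Total order $\preceq$ on the vertices of $T\in\mathcal T_{\mathbf d}$ with root $\rho$: let $S_0=\{\rho\}$;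 for $i=1,\dots,L_{\mathbf d}$ let $P_i$ be the unique path in $T$ that starts at a vertex of $S_{i-1}$, visits no other vertex of $S_{i-1}$, and ends at $\ell_i$, and let $S_i=S_{i-1}\cup P_i$. Then $\preceq$ is the order in which the vertices first appear when the paths $P_1,P_2,\dots,P_{L_{\mathbf d}}$ are read one after the other, each from its starting point to its endpoint $\ell_i$. Growth procedure: the input is $T\in\mathcal T_{\mathbf d}$ and a multiset $\{w_1,\dots,w_d\}$ of $d$ vertices of $T$, listed so that $w_1\preceq w_2\preceq\dots\preceq w_d$. Add new vertices $m+1,\ell_{L_{\mathbf d}+1},\dots,\ell_{L_{\mathbf d}+d-1}$ to $T$ and modify the edges as follows. (1) If $w_1$ is the root of $T$, connect $m+1$ to $w_1$ and re-root the tree at $m+1$. Otherwise, replace the edge $vw_1$ joining $w_1$ to its parent $v$ by the two edges $v(m+1)$ and $(m+1)w_1$. (2) For $j=2,\dots,d$ successively: (a) if $w_j=w_{j-1}$, add an edge from $m+1$ to $\ell_{L_{\mathbf d}+j-1}$ (so that it is a child of $m+1$); (b) if $w_j\ne w_{j-1}$, remove the edge from $w_j$ to its parent $v$, then add an edge from $v$ to $\ell_{L_{\mathbf d}+j-1}$ and an edge from $m+1$ to $w_j$ (so that $\ell_{L_{\mathbf d}+j-1}$ becomes a child of $v$ and $w_j$ becomes a child of $m+1$). The output is the resulting rooted tree. "Uniformly random multiset of size $d$" means uniform over the set of all multisets of size $d$ (repetitions allowed, order ignored) of elements of the given vertex set. *)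

theory Defs
  imports "HOL-Probability.Probability"
begin

datatype vertex = Node nat | Leaf nat

text \<open>A rooted tree is stored with its edges oriented from parent to child, so
  \<open>(u, v) \<in> arcs T\<close> says that \<open>u\<close> is the parent of \<open>v\<close>; the children of a
  vertex carry no order.\<close>

record rtree =
  verts :: "vertex set"
  tree_root :: vertex
  arcs :: "(vertex \<times> vertex) set"

definition rooted_tree :: "rtree \<Rightarrow> bool" where
  "rooted_tree T \<longleftrightarrow>
     finite (verts T) \<and> tree_root T \<in> verts T \<and> arcs T \<subseteq> verts T \<times> verts T \<and>
     (\<forall>u. (u, tree_root T) \<notin> arcs T) \<and>
     (\<forall>v \<in> verts T - {tree_root T}. \<exists>!u. (u, v) \<in> arcs T) \<and>
     (\<forall>v \<in> verts T. (tree_root T, v) \<in> (arcs T)\<^sup>*)"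

definition children :: "rtree \<Rightarrow> vertex \<Rightarrow> vertex set" where
  "children T v = {u. (v, u) \<in> arcs T}"

definition parent :: "rtree \<Rightarrow> vertex \<Rightarrow> vertex" where
  "parent T v = (THE u. (u, v) \<in> arcs T)"

text \<open>The sequence \<open>(d\<^sub>1, \<dots>, d\<^sub>m)\<close> is a list \<open>ds\<close>, with \<open>d\<^sub>i = ds ! (i - 1)\<close>.\<close>

definition num_leaves :: "nat list \<Rightarrow> nat" where
  "num_leaves ds = 1 + (\<Sum>d\<leftarrow>ds. d - 1)"

definition vertex_set :: "nat list \<Rightarrow> vertex set" where
  "vertex_set ds = Node ` {1..length ds} \<union> Leaf ` {1..num_leaves ds}"

definition labelled_trees :: "nat list \<Rightarrow> rtree set" where
  "labelled_trees ds = {T. rooted_tree T \<and> verts T = vertex_set ds \<and>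
     (\<forall>i \<in> {1..length ds}. card (children T (Node i)) = ds ! (i - 1)) \<and>
     (\<forall>i \<in> {1..num_leaves ds}. children T (Leaf i) = {})}"

text \<open>Paths ignore the orientation of the edges and repeat no vertex.\<close>

definition is_path :: "rtree \<Rightarrow> vertex list \<Rightarrow> bool" where
  "is_path T p \<longleftrightarrow> p \<noteq> [] \<and> set p \<subseteq> verts T \<and> distinct p \<and>
     successively (\<lambda>u v. (u, v) \<in> arcs T \<or> (v, u) \<in> arcs T) p"

definition path_from :: "rtree \<Rightarrow> vertex set \<Rightarrow> nat \<Rightarrow> vertex list" where
  "path_from T S i =
     (THE p. is_path T p \<and> hd p \<in> S \<and> set (tl p) \<inter> S = {} \<and> last p = Leaf i)"

primrec explored :: "rtree \<Rightarrow> nat \<Rightarrow> vertex set" where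
  "explored T 0 = {tree_root T}"
| "explored T (Suc i) = explored T i \<union> set (path_from T (explored T i) (Suc i))"

text \<open>The paths \<open>P\<^sub>1, \<dots>, P\<^sub>L\<close> read one after the other; vertices are compared by
  the position of their first occurrence in this word.\<close>

definition reading :: "rtree \<Rightarrow> nat \<Rightarrow> vertex list" where
  "reading T L = concat (map (\<lambda>i. path_from T (explored T (i - 1)) i) [1..<L + 1])"

definition first_pos :: "'a list \<Rightarrow> 'a \<Rightarrow> nat" where
  "first_pos xs x = (LEAST k. k < length xs \<and> xs ! k = x)"

definition vertex_le :: "rtree \<Rightarrow> nat \<Rightarrow> vertex \<Rightarrow> vertex \<Rightarrow> bool" where
  "vertex_le T L u v \<longleftrightarrow> first_pos (reading T L) u \<le> first_pos (reading T L) v"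

definition listing :: "rtree \<Rightarrow> nat \<Rightarrow> vertex multiset \<Rightarrow> vertex list" where
  "listing T L W = (THE ws. mset ws = W \<and> sorted_wrt (vertex_le T L) ws)"

text \<open>In the growth procedure \<open>n = m + 1\<close> is the label of the new internal vertex and
  \<open>L\<close> the number of leaves of the input tree. Parents are taken in the current tree.\<close>

definition grow_first :: "nat \<Rightarrow> vertex \<Rightarrow> rtree \<Rightarrow> rtree" where
  "grow_first n w T =
     (if w = tree_root T
      then T\<lparr>tree_root := Node n, arcs := insert (Node n, w) (arcs T)\<rparr>
      else T\<lparr>arcs := (arcs T - {(parent T w, w)}) \<union> {(parent T w, Node n), (Node n, w)}\<rparr>)"

definition grow_next :: "nat \<Rightarrow> nat \<Rightarrow> vertex list \<Rightarrow> nat \<Rightarrow> rtree \<Rightarrow> rtree" where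
  "grow_next n L ws j T =
     (let w' = ws ! (j - 2); w = ws ! (j - 1); l = Leaf (L + j - 1); v = parent T w in
      if w = w'
      then T\<lparr>arcs := insert (Node n, l) (arcs T)\<rparr>
      else T\<lparr>arcs := (arcs T - {(v, w)}) \<union> {(v, l), (Node n, w)}\<rparr>)"

definition grow :: "nat list \<Rightarrow> rtree \<Rightarrow> vertex multiset \<Rightarrow> rtree" where
  "grow ds T W =
     (let n = length ds + 1; L = num_leaves ds; d = size W; ws = listing T L W;
          T0 = T\<lparr>verts := verts T \<union> {Node n} \<union> Leaf ` {L + 1..L + d - 1}\<rparr>
      in fold (grow_next n L ws) [2..<d + 1] (grow_first n (ws ! 0) T0))"

definition vertex_multisets :: "nat list \<Rightarrow> nat \<Rightarrow> vertex multiset set" where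
  "vertex_multisets ds d = {W. set_mset W \<subseteq> vertex_set ds \<and> size W = d}"

end

theory Submission
  imports Defs
begin

text \<open>Growth is a bijection between pairs (tree, multiset) and trees with one more internal vertex.
  In the grown tree, call \<open>m + 1\<close> slot \<open>0\<close> and the \<open>j\<close>-th new leaf
  slot \<open>j\<close>. Slot \<open>j\<close> sits where \<open>w\<^sub>j\<close> (counting from \<open>0\<close>)
  was attached, so the old tree is recovered by cutting below \<open>m + 1\<close> and plugging the
  resulting \<open>d\<close> pieces into the \<open>d\<close> slots; a repeated \<open>w\<^sub>j\<close> shows up as a
  piece that is itself a slot. Since \<open>u \<preceq> v\<close> is governed by the smallest leaf below
  \<open>u\<close> and \<open>v\<close>, and by ancestry in case of ties, exactly one assignment of pieces to slots
  makes the recovered list sorted: slot \<open>j\<close> receives the unused piece that contains slot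
  \<open>j + 1\<close> if there is one, and otherwise the unused piece that contains the smallest old leaf
  lying in an unused piece.\<close>

subsection \<open>Rooted trees\<close>

text \<open>The slot test has to precede the leaf test because a vertex may owe its place in the
  order to leaves outside its own piece: if slot j + 1 lies in the piece of \<open>ws ! j\<close>,
  then \<open>ws ! (j + 1)\<close> is plugged in below \<open>ws ! j\<close>, and the smallest old
  leaf below \<open>ws ! j\<close> may belong to a later piece. Plugging pieces back could fail in
  two ways: the rule might get stuck, or the result might contain a cycle. A count of pieces against
  slots excludes the first. For the second, the priority of the slot test forces slot i into a piece
  of index below i or outside all pieces, so every re-plugged arc leads to a larger piece index.
  Growth is sequential and looks up parents in the current tree. \<open>grown_arcs\<close> replaces
  it by a static list of final parents, and its degree counts need only that equal entries of
  \<open>ws\<close> are adjacent. They are thus available for the recovered list before that list is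
  known to be sorted, which can be asked only once the recovered graph is a tree.\<close>

lemma rooted_tree_parent_unique:
  assumes "rooted_tree T" "(u, v) \<in> arcs T" "(u', v) \<in> arcs T"
  shows "u = u'"
proof -
  have "v \<in> verts T - {tree_root T}"
    using assms unfolding rooted_tree_def by auto
  then have "\<exists>!u. (u, v) \<in> arcs T" using assms(1) unfolding rooted_tree_def by blast
  then show ?thesis using assms by blast
qed

lemma rooted_tree_arcs_verts:
  assumes "rooted_tree T" "(u, v) \<in> arcs T"
  shows "u \<in> verts T" "v \<in> verts T"
  using assms unfolding rooted_tree_def by auto

lemma rooted_tree_parent_ex:
  assumes "rooted_tree T" "v \<in> verts T" "v \<noteq> tree_root T"
  obtains u where "(u, v) \<in> arcs T"
  using assms unfolding rooted_tree_def by blast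

text \<open>Induction down from the root, which has no incoming arc: a cycle through
  \<open>v\<close> enters \<open>v\<close> by its only parent, so it would already pass through that
  parent.\<close>

lemma rooted_tree_acyclic:
  assumes T: "rooted_tree T"
  shows "(v, v) \<notin> (arcs T)\<^sup>+"
proof
  assume v: "(v, v) \<in> (arcs T)\<^sup>+"
  then obtain z where "(z, v) \<in> arcs T" by (meson tranclE)
  then have "v \<in> verts T" using rooted_tree_arcs_verts[OF T] by blast
  then have "(tree_root T, v) \<in> (arcs T)\<^sup>*" using T unfolding rooted_tree_def by blast
  then have "(v, v) \<notin> (arcs T)\<^sup>+"
  proof (induction rule: rtrancl_induct)
    case base
    show ?case using T unfolding rooted_tree_def by (meson tranclE)
  next
    case (step u v)
    show ?case
    proof
      assume "(v, v) \<in> (arcs T)\<^sup>+"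
      then obtain z where z: "(v, z) \<in> (arcs T)\<^sup>*" "(z, v) \<in> arcs T" by (meson tranclD2)
      then have "z = u" using rooted_tree_parent_unique[OF T] step.hyps by blast
      then have "(u, u) \<in> (arcs T)\<^sup>+" using z step.hyps by auto
      then show False using step.IH by blast
    qed
  qed
  then show False using v by blast
qed

lemma rooted_tree_ancestors_comparable:
  assumes T: "rooted_tree T" and "(u, w) \<in> (arcs T)\<^sup>*" "(v, w) \<in> (arcs T)\<^sup>*"
  shows "(u, v) \<in> (arcs T)\<^sup>* \<or> (v, u) \<in> (arcs T)\<^sup>*"
proof -
  have "single_valued ((arcs T)\<inverse>)"
    using rooted_tree_parent_unique[OF T] by (auto simp: single_valued_def)
  from single_valued_confluent[OF this, of w u v] assms(2,3) show ?thesis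
    by (auto simp: rtrancl_converse)
qed

lemma rooted_tree_rank:
  assumes T: "rooted_tree T"
  obtains rk :: "vertex \<Rightarrow> nat"
  where "\<And>u v. (u, v) \<in> arcs T \<Longrightarrow> rk u < rk v"
proof
  fix u v assume uv: "(u, v) \<in> arcs T"
  let ?anc = "\<lambda>v. {u. (u, v) \<in> (arcs T)\<^sup>+}"
  have sub: "(arcs T)\<^sup>+ \<subseteq> verts T \<times> verts T" and fin: "finite (verts T)"
    using T unfolding rooted_tree_def by (auto intro!: trancl_subset_Sigma)
  have "?anc v \<subseteq> verts T" using sub by auto
  then have "finite (?anc v)" using fin finite_subset by blast
  moreover have "?anc u \<subset> ?anc v"
    using uv rooted_tree_acyclic[OF T, of u] by auto
  ultimately show "card (?anc u) < card (?anc v)" by (rule psubset_card_mono)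
qed

text \<open>Reachability from the root is traded for a rank that increases along arcs: climbing to
  parents must stop, and only the root lacks a parent. Both the grown and the recovered graph are
  shown to be trees this way, each with its own rank.\<close>

lemma rooted_treeI:
  fixes rk :: "vertex \<Rightarrow> nat"
  assumes fin: "finite (verts T)" and root: "tree_root T \<in> verts T"
    and sub: "arcs T \<subseteq> verts T \<times> verts T"
    and noroot: "\<And>u. (u, tree_root T) \<notin> arcs T"
    and ex: "\<And>v. v \<in> verts T \<Longrightarrow> v \<noteq> tree_root T \<Longrightarrow> \<exists>u. (u, v) \<in> arcs T"
    and uni: "\<And>u u' v. (u, v) \<in> arcs T \<Longrightarrow> (u', v) \<in> arcs T \<Longrightarrow> u = u'"
    and rk: "\<And>u v. (u, v) \<in> arcs T \<Longrightarrow> rk u < rk v"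
  shows "rooted_tree T"
proof -
  have reach: "v \<in> verts T \<Longrightarrow> (tree_root T, v) \<in> (arcs T)\<^sup>*" for v
  proof (induction "rk v" arbitrary: v rule: less_induct)
    case less
    show ?case
    proof (cases "v = tree_root T")
      case False
      then obtain u where u: "(u, v) \<in> arcs T" using ex less.prems by blast
      then have "(tree_root T, u) \<in> (arcs T)\<^sup>*" using less.hyps rk sub by auto
      then show ?thesis using u by auto
    qed auto
  qed
  show ?thesis unfolding rooted_tree_def
    using fin root sub noroot reach ex uni by blast
qed

text \<open>The root is the only vertex without an incoming arc. Re-rooting therefore never has to
  be compared when two trees are shown equal.\<close>

lemma rooted_tree_eqI:
  assumes T: "rooted_tree T" and T': "rooted_tree (T' :: rtree)"
    and v: "verts T = verts T'" and a: "arcs T = arcs T'"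
  shows "T = T'"
proof -
  have "tree_root T' \<in> verts T" "\<And>u. (u, tree_root T') \<notin> arcs T"
    using T' v a unfolding rooted_tree_def by auto
  then have "tree_root T = tree_root T'" using rooted_tree_parent_ex[OF T] by metis
  then show ?thesis using v a by simp
qed

lemma labelled_treesD:
  assumes "T \<in> labelled_trees ds"
  shows "rooted_tree T" "verts T = vertex_set ds"
  using assms unfolding labelled_trees_def by auto

lemma leaf_no_child:
  assumes "T \<in> labelled_trees ds"
  shows "(Leaf i, v) \<notin> arcs T"
proof
  assume a: "(Leaf i, v) \<in> arcs T"
  then have "Leaf i \<in> vertex_set ds"
    using rooted_tree_arcs_verts labelled_treesD[OF assms] by metis
  then have "i \<in> {1..num_leaves ds}" unfolding vertex_set_def by auto
  then show False using assms a unfolding labelled_trees_def children_def by auto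
qed

text \<open>Every internal vertex has a child because all degrees are positive, so a downward walk
  can stop only at a leaf; \<open>M - rk v\<close> bounds its length.\<close>

lemma leaf_below:
  assumes T: "T \<in> labelled_trees ds" and pos: "\<forall>i < length ds. ds ! i \<ge> 1"
    and v: "v \<in> vertex_set ds"
  obtains i where "i \<in> {1..num_leaves ds}" "(v, Leaf i) \<in> (arcs T)\<^sup>*"
proof -
  note rt = labelled_treesD(1)[OF T] and V = labelled_treesD(2)[OF T]
  obtain rk :: "vertex \<Rightarrow> nat" where rk: "\<And>u v. (u, v) \<in> arcs T \<Longrightarrow> rk u < rk v"
    using rooted_tree_rank[OF rt] by blast
  have fin: "finite (vertex_set ds)" unfolding vertex_set_def by auto
  define M where "M = Max (rk ` vertex_set ds)"
  have M: "rk v \<le> M" if "v \<in> vertex_set ds" for v unfolding M_def using fin that by auto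
  have "\<exists>i \<in> {1..num_leaves ds}. (v, Leaf i) \<in> (arcs T)\<^sup>*" using v
  proof (induction "M - rk v" arbitrary: v rule: less_induct)
    case less
    show ?case
    proof (cases v)
      case (Leaf i)
      then show ?thesis using less.prems unfolding vertex_set_def by auto
    next
      case (Node i)
      then have i: "i \<in> {1..length ds}" using less.prems unfolding vertex_set_def by auto
      then have "card (children T v) = ds ! (i - 1)"
        using T Node unfolding labelled_trees_def by auto
      moreover have "ds ! (i - 1) \<ge> 1" using pos i by auto
      ultimately have "children T v \<noteq> {}" by auto
      then obtain u where u: "(v, u) \<in> arcs T" unfolding children_def by auto
      then have uV: "u \<in> vertex_set ds" using rooted_tree_arcs_verts[OF rt] V by blast
      have "M - rk u < M - rk v" using rk[OF u] M[OF uV] by linarith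
      then show ?thesis using less.hyps uV u by (meson converse_rtrancl_into_rtrancl)
    qed
  qed
  then show ?thesis using that by blast
qed

subsection \<open>The order of first visits\<close>

text \<open>The paths of \<open>path_from\<close> with all edges traversed downwards. Explored sets
  are closed under parents, so the paths that occur never climb.\<close>

definition descent :: "rtree \<Rightarrow> vertex set \<Rightarrow> vertex \<Rightarrow> vertex list \<Rightarrow> bool" where
  "descent T S v p \<longleftrightarrow> p \<noteq> [] \<and> successively (\<lambda>u v. (u, v) \<in> arcs T) p \<and>
     hd p \<in> S \<and> set (tl p) \<inter> S = {} \<and> last p = v"

lemma descent_ex:
  assumes T: "rooted_tree T" and root: "tree_root T \<in> S" and v: "v \<in> verts T"
    and closed: "\<And>u v. (u, v) \<in> arcs T \<Longrightarrow> v \<in> S \<Longrightarrow> u \<in> S"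
  obtains p where "descent T S v p" "set p \<subseteq> {u. (u, v) \<in> (arcs T)\<^sup>*}"
    "{u. (u, v) \<in> (arcs T)\<^sup>*} \<subseteq> S \<union> set p"
proof -
  have closed': "(u, v) \<in> (arcs T)\<^sup>* \<Longrightarrow> v \<in> S \<Longrightarrow> u \<in> S" for u v
    by (induction rule: converse_rtrancl_induct) (use closed in blast)+
  have "(tree_root T, v) \<in> (arcs T)\<^sup>*" using T v unfolding rooted_tree_def by blast
  then have "\<exists>p. descent T S v p \<and> set p \<subseteq> {u. (u, v) \<in> (arcs T)\<^sup>*} \<and>
    {u. (u, v) \<in> (arcs T)\<^sup>*} \<subseteq> S \<union> set p"
  proof (induction rule: rtrancl_induct)
    case base
    have "{u. (u, tree_root T) \<in> (arcs T)\<^sup>*} = {tree_root T}"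
      using T unfolding rooted_tree_def by (auto elim: rtranclE)
    then show ?case
      using root by (intro exI[of _ "[tree_root T]"]) (auto simp: descent_def)
  next
    case (step u v)
    show ?case
    proof (cases "v \<in> S")
      case True
      then show ?thesis using closed'
        by (intro exI[of _ "[v]"]) (auto simp: descent_def)
    next
      case False
      from step.IH obtain p where p: "descent T S u p"
        "set p \<subseteq> {w. (w, u) \<in> (arcs T)\<^sup>*}"
        "{w. (w, u) \<in> (arcs T)\<^sup>*} \<subseteq> S \<union> set p" by blast
      have "{w. (w, v) \<in> (arcs T)\<^sup>*} = insert v {w. (w, u) \<in> (arcs T)\<^sup>*}"
      proof (intro set_eqI iffI; clarsimp)
        fix w assume "(w, v) \<in> (arcs T)\<^sup>*" "(w, u) \<notin> (arcs T)\<^sup>*"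
        then show "w = v"
          using step.hyps(2) rooted_tree_parent_unique[OF T, of _ v u] by (metis rtranclE)
      next
        fix w assume "w = v \<or> (w, u) \<in> (arcs T)\<^sup>*"
        then show "(w, v) \<in> (arcs T)\<^sup>*" using step.hyps(2) by auto
      qed
      moreover have "descent T S v (p @ [v])"
        using p(1) False step.hyps by (auto simp: descent_def successively_append_iff)
      ultimately show ?thesis using p(2,3) by (intro exI[of _ "p @ [v]"]) auto
    qed
  qed
  then show ?thesis using that by blast
qed

lemma descent_unique:
  assumes T: "rooted_tree T"
  shows "descent T S v p \<Longrightarrow> descent T S v q \<Longrightarrow> p = q"
proof (induction p arbitrary: q v rule: rev_induct)
  case Nil
  then show ?case by (simp add: descent_def)
next
  case (snoc x p)
  then have x: "x = v" by (simp add: descent_def)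
  obtain q' where q: "q = q' @ [v]"
    using snoc.prems(2) unfolding descent_def by (metis append_butlast_last_id)
  show ?case
  proof (cases "p = []")
    case True
    then have "v \<in> S" using snoc.prems x by (simp add: descent_def)
    then have "q' = []" using snoc.prems(2) q by (auto simp: descent_def)
    then show ?thesis using True q x by simp
  next
    case False
    then have v: "v \<notin> S" using snoc.prems(1) x by (auto simp: descent_def)
    then have q': "q' \<noteq> []" using snoc.prems(2) q by (auto simp: descent_def)
    have a: "(last p, v) \<in> arcs T" "(last q', v) \<in> arcs T"
      using snoc.prems x q q' False by (auto simp: descent_def successively_append_iff)
    then have "last p = last q'" using rooted_tree_parent_unique[OF T] by blast
    then have "descent T S (last p) p" "descent T S (last p) q'"
      using snoc.prems x q q' False by (auto simp: descent_def successively_append_iff)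
    then show ?thesis using snoc.IH q x by blast
  qed
qed

lemma descent_distinct:
  assumes T: "rooted_tree T" and "descent T S v p"
  shows "distinct p"
proof -
  obtain rk :: "vertex \<Rightarrow> nat" where rk: "\<And>u v. (u, v) \<in> arcs T \<Longrightarrow> rk u < rk v"
    using rooted_tree_rank[OF T] by blast
  have "successively (\<lambda>u v. rk u < rk v) p"
    using assms(2) rk unfolding descent_def by (auto intro: successively_mono)
  then have "sorted_wrt (\<lambda>u v. rk u < rk v) p"
    by (subst (asm) successively_conv_sorted_wrt) (auto simp: transp_def)
  then show ?thesis by (induction p) auto
qed

text \<open>After a step down to \<open>b\<close>, a step up would lead back to \<open>a\<close>,
  the only parent of \<open>b\<close>, against distinctness.\<close>

lemma is_path_arcs_down:
  assumes T: "rooted_tree T"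
  shows "distinct (a # b # r) \<Longrightarrow> (a, b) \<in> arcs T \<Longrightarrow>
    successively (\<lambda>u v. (u, v) \<in> arcs T \<or> (v, u) \<in> arcs T) (a # b # r) \<Longrightarrow>
    successively (\<lambda>u v. (u, v) \<in> arcs T) (a # b # r)"
proof (induction r arbitrary: a b)
  case (Cons c r)
  have "(b, c) \<in> arcs T"
    using Cons.prems rooted_tree_parent_unique[OF T, of a b c] by auto
  then show ?case using Cons.IH[of b c] Cons.prems by auto
qed auto

lemma path_from_eq:
  assumes T: "rooted_tree T" and p: "descent T S (Leaf i) p"
    and closed: "\<And>u v. (u, v) \<in> arcs T \<Longrightarrow> v \<in> S \<Longrightarrow> u \<in> S"
    and v: "Leaf i \<in> verts T"
  shows "path_from T S i = p"
  unfolding path_from_def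
proof (rule the_equality)
  have "set p \<subseteq> verts T"
  proof
    fix x assume "x \<in> set p"
    then obtain ys zs where "p = ys @ x # zs" by (meson split_list)
    then show "x \<in> verts T"
      using p v rooted_tree_arcs_verts[OF T]
      by (cases zs) (auto simp: descent_def successively_append_iff)
  qed
  moreover have "successively (\<lambda>u v. (u, v) \<in> arcs T \<or> (v, u) \<in> arcs T) p"
    using p unfolding descent_def by (auto elim: successively_mono)
  ultimately show "is_path T p \<and> hd p \<in> S \<and> set (tl p) \<inter> S = {} \<and> last p = Leaf i"
    using p descent_distinct[OF T p] unfolding descent_def is_path_def by auto
next
  fix q assume q: "is_path T q \<and> hd q \<in> S \<and> set (tl q) \<inter> S = {} \<and> last q = Leaf i"
  have "successively (\<lambda>u v. (u, v) \<in> arcs T) q"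
  proof (cases q rule: remdups_adj.cases)
    case (3 a b r)
    \<comment> \<open>Had the first step gone up, \<open>closed\<close> would put \<open>b\<close>
      into \<open>S\<close>, where only the head of \<open>q\<close> may lie.\<close>
    then have "(a, b) \<in> arcs T" using q closed unfolding is_path_def by auto
    then show ?thesis using is_path_arcs_down[OF T] q 3 unfolding is_path_def by blast
  qed auto
  then have "descent T S (Leaf i) q" using q unfolding descent_def is_path_def by auto
  then show "q = p" using descent_unique[OF T] p by blast
qed

section \<open>First occurrences in the word of paths\<close>

lemma first_pos_props:
  assumes "x \<in> set xs"
  shows "first_pos xs x < length xs" "xs ! first_pos xs x = x"
proof -
  obtain k where "k < length xs \<and> xs ! k = x" using assms by (meson in_set_conv_nth)
  then have "first_pos xs x < length xs \<and> xs ! first_pos xs x = x"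
    unfolding first_pos_def by (rule LeastI)
  then show "first_pos xs x < length xs" "xs ! first_pos xs x = x" by auto
qed

lemma first_pos_less:
  assumes "x \<in> set (take n xs)"
  shows "first_pos xs x < n"
proof -
  obtain k where k: "k < length xs" "k < n" "xs ! k = x"
    using assms by (auto simp: in_set_conv_nth)
  then have "first_pos xs x \<le> k" unfolding first_pos_def by (intro Least_le) auto
  then show ?thesis using k by simp
qed

lemma first_pos_ge:
  assumes "x \<in> set xs" "x \<notin> set (take n xs)"
  shows "first_pos xs x \<ge> n"
proof (rule ccontr)
  assume "\<not> ?thesis"
  then have "x \<in> set (take n xs)" using first_pos_props[OF assms(1)]
    by (metis in_set_conv_nth length_take min_less_iff_conj nth_take not_le_imp_less)
  then show False using assms(2) by simp
qed

lemma reading_Suc: "reading T (Suc i) = reading T i @ path_from T (explored T i) (Suc i)"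
  unfolding reading_def by simp

lemma take_reading:
  assumes "i \<le> j"
  shows "take (length (reading T i)) (reading T j) = reading T i"
proof -
  have "\<exists>zs. reading T j = reading T i @ zs"
    using assms by (induction j rule: dec_induct) (auto simp: reading_Suc)
  then show ?thesis by auto
qed

context
  fixes ds :: "nat list" and T :: rtree
  assumes T: "T \<in> labelled_trees ds"
begin

text \<open>Proved together, since the next path is a descent only if the explored set is closed
  under parents, which its description by ancestors provides. The root is inserted separately for
  \<open>i = 0\<close>.\<close>

lemma explored_eq:
  "i \<le> num_leaves ds \<Longrightarrow>
   explored T i = insert (tree_root T) {v. \<exists>k \<in> {1..i}. (v, Leaf k) \<in> (arcs T)\<^sup>*}"
  "i < num_leaves ds \<Longrightarrow>
   descent T (explored T i) (Leaf (Suc i)) (path_from T (explored T i) (Suc i))"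
proof -
  note rt = labelled_treesD(1)[OF T] and V = labelled_treesD(2)[OF T]
  have step: "descent T (explored T i) (Leaf (Suc i)) (path_from T (explored T i) (Suc i)) \<and>
     explored T (Suc i) = insert (tree_root T) {v. \<exists>k \<in> {1..Suc i}. (v, Leaf k) \<in> (arcs T)\<^sup>*}"
    if e: "explored T i = insert (tree_root T) {v. \<exists>k \<in> {1..i}. (v, Leaf k) \<in> (arcs T)\<^sup>*}"
      and i: "i < num_leaves ds" for i
  proof -
    have closed: "(u, v) \<in> arcs T \<Longrightarrow> v \<in> explored T i \<Longrightarrow> u \<in> explored T i" for u v
      using rt unfolding e rooted_tree_def by (auto intro: converse_rtrancl_into_rtrancl)
    have l: "Leaf (Suc i) \<in> verts T" using i V unfolding vertex_set_def by auto
    obtain p where p: "descent T (explored T i) (Leaf (Suc i)) p"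
      "set p \<subseteq> {u. (u, Leaf (Suc i)) \<in> (arcs T)\<^sup>*}"
      "{u. (u, Leaf (Suc i)) \<in> (arcs T)\<^sup>*} \<subseteq> explored T i \<union> set p"
      using descent_ex[OF rt _ l, of "explored T i"] closed e by blast
    have "path_from T (explored T i) (Suc i) = p"
      by (rule path_from_eq[OF rt p(1) _ l]) (rule closed)
    moreover have "{1..Suc i} = insert (Suc i) {1..i}" by auto
    ultimately show ?thesis using p e by (simp, blast)
  qed
  have 1: "i \<le> num_leaves ds \<Longrightarrow>
   explored T i = insert (tree_root T) {v. \<exists>k \<in> {1..i}. (v, Leaf k) \<in> (arcs T)\<^sup>*}" for i
    by (induction i) (use step in auto)
  then show "i \<le> num_leaves ds \<Longrightarrow>
   explored T i = insert (tree_root T) {v. \<exists>k \<in> {1..i}. (v, Leaf k) \<in> (arcs T)\<^sup>*}" by blast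
  show "i < num_leaves ds \<Longrightarrow>
   descent T (explored T i) (Leaf (Suc i)) (path_from T (explored T i) (Suc i))"
    using step[of i] 1[of i] by simp
qed

lemma set_reading:
  assumes "1 \<le> i" "i \<le> num_leaves ds"
  shows "set (reading T i) = explored T i"
proof -
  \<comment> \<open>The word is empty at \<open>i = 0\<close>, where the root is already explored;
    the root is first read as the start of the first path.\<close>
  have *: "insert (tree_root T) (set (reading T i)) = explored T i" for i
  proof (induction i)
    case 0
    show ?case by (simp add: reading_def)
  next
    case (Suc i)
    then show ?case by (auto simp: reading_Suc)
  qed
  have "tree_root T \<in> set (reading T i)" using assms
  proof (induction i rule: dec_induct)
    case base
    have "descent T {tree_root T} (Leaf 1) (path_from T {tree_root T} 1)"
      using explored_eq(2)[of 0] assms by simp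
    then have "tree_root T \<in> set (path_from T {tree_root T} 1)"
      unfolding descent_def by (metis hd_in_set singletonD)
    then show ?case by (simp add: reading_def)
  next
    case (step i)
    then show ?case by (simp add: reading_Suc)
  qed
  then show ?thesis using *[of i] by (simp add: insert_absorb)
qed

text \<open>Inside a path the parent is the preceding entry. The start of a path is already
  explored, hence so is its parent, which then occurs in the earlier part of the word.\<close>

lemma reading_parent_before:
  assumes "i \<le> num_leaves ds" "k < length (reading T i)" "(u, reading T i ! k) \<in> arcs T"
  shows "u \<in> set (take k (reading T i))"
  using assms
proof (induction i arbitrary: k)
  case 0
  then show ?case by (simp add: reading_def)
next
  case (Suc i)
  note rt = labelled_treesD(1)[OF T]
  let ?p = "path_from T (explored T i) (Suc i)"
  have p: "descent T (explored T i) (Leaf (Suc i)) ?p" using explored_eq(2) Suc.prems by simp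
  show ?case
  proof (cases "k < length (reading T i)")
    case True
    then show ?thesis using Suc by (simp add: reading_Suc nth_append)
  next
    case False
    define m where "m = k - length (reading T i)"
    have m: "k = length (reading T i) + m" using False by (simp add: m_def)
    have u: "(u, ?p ! m) \<in> arcs T" and ml: "m < length ?p"
      using Suc.prems m by (auto simp: reading_Suc)
    show ?thesis
    proof (cases m)
      case 0
      then have h: "?p ! m \<in> explored T i" using p unfolding descent_def by (simp flip: hd_conv_nth)
      have "?p ! m \<noteq> tree_root T" using u rt unfolding rooted_tree_def by metis
      then obtain j where j: "j \<in> {1..i}" "(?p ! m, Leaf j) \<in> (arcs T)\<^sup>*"
        using h explored_eq(1)[of i] Suc.prems by auto
      then have "u \<in> explored T i"
        using u explored_eq(1)[of i] Suc.prems by (auto intro: converse_rtrancl_into_rtrancl)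
      then have "u \<in> set (reading T i)" using j set_reading[of i] Suc.prems by auto
      then show ?thesis using m by (simp add: reading_Suc)
    next
      case (Suc m')
      then have "(?p ! m', ?p ! m) \<in> arcs T"
        using p ml unfolding descent_def successively_conv_nth by auto
      then have "u = ?p ! m'" using u rooted_tree_parent_unique[OF rt] by blast
      then have "u \<in> set (take m ?p)" using Suc ml by (auto simp: in_set_conv_nth)
      then show ?thesis using m by (simp add: reading_Suc)
    qed
  qed
qed

end

text \<open>The vertices first met on \<open>P\<^sub>i\<close> are those whose smallest descendant leaf is
  \<open>\<ell>\<^sub>i\<close>, so \<open>\<preceq>\<close> is determined by these minima and by ancestry.\<close>

definition pos :: "nat list \<Rightarrow> rtree \<Rightarrow> vertex \<Rightarrow> nat" where
  "pos ds T = first_pos (reading T (num_leaves ds))"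

context
  fixes ds :: "nat list" and T :: rtree
  assumes T: "T \<in> labelled_trees ds" and ge1: "\<forall>i < length ds. ds ! i \<ge> 1"
begin

lemma vertex_in_reading:
  assumes "v \<in> vertex_set ds"
  shows "v \<in> set (reading T (num_leaves ds))"
proof -
  have "num_leaves ds \<ge> 1" unfolding num_leaves_def by simp
  moreover obtain i where "i \<in> {1..num_leaves ds}" "(v, Leaf i) \<in> (arcs T)\<^sup>*"
    using leaf_below[OF T ge1 assms] .
  ultimately show ?thesis using set_reading[OF T] explored_eq(1)[OF T] by auto
qed

lemma pos_inj:
  assumes "u \<in> vertex_set ds" "v \<in> vertex_set ds" "pos ds T u = pos ds T v"
  shows "u = v"
  using assms vertex_in_reading first_pos_props(2) unfolding pos_def by metis

lemma pos_arc:
  assumes "(u, v) \<in> arcs T"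
  shows "pos ds T u < pos ds T v"
proof -
  have "v \<in> vertex_set ds" using assms rooted_tree_arcs_verts labelled_treesD[OF T] by metis
  then have "v \<in> set (reading T (num_leaves ds))" by (rule vertex_in_reading)
  from first_pos_props[OF this] assms show ?thesis unfolding pos_def
    using reading_parent_before[OF T order_refl, of "first_pos (reading T (num_leaves ds)) v" u]
    by (auto intro: first_pos_less)
qed

lemma pos_ancestor:
  assumes "(u, v) \<in> (arcs T)\<^sup>*"
  shows "pos ds T u \<le> pos ds T v"
  using assms by (induction rule: rtrancl_induct) (use pos_arc in force)+

text \<open>The end of \<open>reading T i\<close> separates the two: all ancestors of leaf
  \<open>i\<close> have been read by then, and \<open>v\<close> has not. With
  \<open>pos_arc\<close>, \<open>pos_ancestor\<close> and \<open>pos_inj\<close>, this is how the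
  order is handled from here on, without the paths.\<close>

lemma pos_smaller_leaf:
  assumes i: "i \<in> {1..num_leaves ds}" "(u, Leaf i) \<in> (arcs T)\<^sup>*"
    and v: "v \<in> vertex_set ds" "\<And>k. k \<in> {1..i} \<Longrightarrow> (v, Leaf k) \<notin> (arcs T)\<^sup>*"
  shows "pos ds T u < pos ds T v"
proof -
  let ?r = "reading T (num_leaves ds)"
  have set: "set (reading T i) = insert (tree_root T) {v. \<exists>k \<in> {1..i}. (v, Leaf k) \<in> (arcs T)\<^sup>*}"
    using set_reading[OF T] explored_eq(1)[OF T] i by auto
  have take: "take (length (reading T i)) ?r = reading T i" using take_reading i by auto
  have "Leaf i \<in> verts T" using i labelled_treesD(2)[OF T] unfolding vertex_set_def by auto
  then have "(tree_root T, Leaf i) \<in> (arcs T)\<^sup>*"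
    using labelled_treesD(1)[OF T] unfolding rooted_tree_def by blast
  then have "v \<noteq> tree_root T" using v(2)[of i] i by auto
  then have "v \<notin> set (reading T i)" using v(2) set by auto
  then have "pos ds T v \<ge> length (reading T i)" unfolding pos_def
    using vertex_in_reading[OF v(1)] take by (intro first_pos_ge) auto
  moreover have "u \<in> set (reading T i)" using i set by auto
  then have "pos ds T u < length (reading T i)" unfolding pos_def
    using take by (intro first_pos_less) auto
  ultimately show ?thesis by simp
qed

text \<open>Sorting by an injective key leaves no choice, so the description in
  \<open>listing\<close> is well defined and multisets can be treated as sorted lists.\<close>

lemma listing_eq:
  assumes "set ws \<subseteq> vertex_set ds" "sorted (map (pos ds T) ws)"
  shows "listing T (num_leaves ds) (mset ws) = ws"
proof -
  have le: "vertex_le T (num_leaves ds) = (\<lambda>u v. pos ds T u \<le> pos ds T v)"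
    by (auto simp: vertex_le_def pos_def fun_eq_iff)
  show ?thesis unfolding listing_def le
  proof (rule the_equality)
    show "mset ws = mset ws \<and> sorted_wrt (\<lambda>u v. pos ds T u \<le> pos ds T v) ws"
      using assms(2) by (simp add: sorted_wrt_map)
  next
    fix vs assume vs: "mset vs = mset ws \<and> sorted_wrt (\<lambda>u v. pos ds T u \<le> pos ds T v) vs"
    then have "set vs \<subseteq> vertex_set ds" using assms(1) by (metis set_mset_mset)
    then have inj: "inj_on (pos ds T) (set vs \<union> set ws)"
      using pos_inj assms(1) by (meson Un_iff inj_onI subsetD)
    have "map (pos ds T) vs = map (pos ds T) ws"
      using vs assms(2) properties_for_sort[of "map (pos ds T) vs" "map (pos ds T) ws"]
        properties_for_sort[of "map (pos ds T) ws" "map (pos ds T) ws"]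
      by (simp add: sorted_wrt_map)
    then show "vs = ws" using inj by (meson map_inj_on)
  qed
qed

end

subsection \<open>Closed form of the growth procedure\<close>

definition slot :: "nat list \<Rightarrow> nat \<Rightarrow> vertex" where
  "slot ds j = (if j = 0 then Node (length ds + 1) else Leaf (num_leaves ds + j))"

text \<open>Organised by target, with parents taken in the original \<open>A\<close> only. If
  \<open>ws ! 0\<close> is the root of \<open>A\<close>, slot 0 receives no parent, which encodes
  the re-rooting.\<close>

definition grown_arcs ::
  "nat list \<Rightarrow> (vertex \<times> vertex) set \<Rightarrow> vertex list \<Rightarrow> (vertex \<times> vertex) set" where
  "grown_arcs ds A ws =
     {(u, v). v \<in> vertex_set ds \<and> (if v \<in> set ws then u = slot ds 0 else (u, v) \<in> A)} \<union>
     {(u, slot ds j) | u j. j < length ws \<and>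
        (if 0 < j \<and> ws ! j = ws ! (j - 1) then u = slot ds 0 else (u, ws ! j) \<in> A)}"

text \<open>The part of sortedness that does not mention the tree. It suffices for counting
  children, so the counts apply to the recovered list before that list is known to be
  sorted.\<close>

definition grouped :: "'a list \<Rightarrow> bool" where
  "grouped ws \<longleftrightarrow> (\<forall>i j. i < j \<longrightarrow> j < length ws \<longrightarrow> ws ! i = ws ! j \<longrightarrow> ws ! (j - 1) = ws ! j)"

text \<open>Indexes the children of the new vertex so that child j is the piece for slot j. A run of
  equal entries \<open>w\<close> gives a chain: each slot of the run is filled by the next slot, and
  the last one by \<open>w\<close> itself, although growth attaches \<open>w\<close> at the start of
  the run.\<close>

definition new_child :: "nat list \<Rightarrow> vertex list \<Rightarrow> nat \<Rightarrow> vertex" where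
  "new_child ds ws j =
     (if Suc j < length ws \<and> ws ! Suc j = ws ! j then slot ds (Suc j) else ws ! j)"

lemma slot_inject [simp]: "slot ds i = slot ds j \<longleftrightarrow> i = j"
  by (auto simp: slot_def)

lemma slot_notin [simp]: "slot ds j \<notin> vertex_set ds"
  by (auto simp: slot_def vertex_set_def)

lemma vertex_set_finite [simp]: "finite (vertex_set ds)"
  by (simp add: vertex_set_def)

lemma num_leaves_snoc: "num_leaves (ds @ [d]) = num_leaves ds + (d - 1)"
  by (simp add: num_leaves_def)

lemma vertex_set_snoc:
  assumes "d \<ge> 1"
  shows "vertex_set (ds @ [d]) = vertex_set ds \<union> slot ds ` {..<d}"
proof -
  have "slot ds ` {..<d} = insert (slot ds 0) (slot ds ` {1..<d})"
    using assms by auto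
  also have "slot ds ` {1..<d} = Leaf ` ((+) (num_leaves ds)) ` {1..<d}"
    unfolding image_image by (auto simp: slot_def)
  also have "(+) (num_leaves ds) ` {1..<d} = {num_leaves ds + 1..<num_leaves ds + d}"
    by (simp add: add.commute)
  finally have "slot ds ` {..<d} =
    insert (Node (length ds + 1)) (Leaf ` {num_leaves ds + 1..<num_leaves ds + d})"
    by (simp add: slot_def)
  moreover have "{1..num_leaves (ds @ [d])} =
    {1..num_leaves ds} \<union> {num_leaves ds + 1..<num_leaves ds + d}"
    using assms by (auto simp: num_leaves_snoc)
  moreover have "{1..length (ds @ [d])} = insert (length ds + 1) {1..length ds}" by auto
  ultimately show ?thesis unfolding vertex_set_def by (simp add: image_Un) blast
qed

lemma grown_arcs_old:
  "v \<in> vertex_set ds \<Longrightarrow>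
   (u, v) \<in> grown_arcs ds A ws \<longleftrightarrow> (if v \<in> set ws then u = slot ds 0 else (u, v) \<in> A)"
  unfolding grown_arcs_def by auto

lemma grown_arcs_slot:
  "j < length ws \<Longrightarrow> (u, slot ds j) \<in> grown_arcs ds A ws \<longleftrightarrow>
   (if 0 < j \<and> ws ! j = ws ! (j - 1) then u = slot ds 0 else (u, ws ! j) \<in> A)"
  unfolding grown_arcs_def by (auto split: if_splits)

lemma grown_arcs_target:
  assumes "(u, v) \<in> grown_arcs ds A ws"
  obtains "v \<in> vertex_set ds" | j where "j < length ws" "v = slot ds j"
  using assms unfolding grown_arcs_def by auto

lemma grown_arcs_source:
  assumes "(u, v) \<in> grown_arcs ds A ws" "A \<subseteq> vertex_set ds \<times> vertex_set ds"
  shows "u \<in> vertex_set ds \<or> u = slot ds 0"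
  using assms unfolding grown_arcs_def by (auto split: if_splits)

lemma grown_arcs_eqI:
  assumes "\<And>u v. (u, v) \<in> A' \<Longrightarrow> v \<in> vertex_set ds \<or> (\<exists>j < length ws. v = slot ds j)"
    and "\<And>u v. v \<in> vertex_set ds \<Longrightarrow>
      (u, v) \<in> A' \<longleftrightarrow> (if v \<in> set ws then u = slot ds 0 else (u, v) \<in> A)"
    and "\<And>u j. j < length ws \<Longrightarrow> (u, slot ds j) \<in> A' \<longleftrightarrow>
      (if 0 < j \<and> ws ! j = ws ! (j - 1) then u = slot ds 0 else (u, ws ! j) \<in> A)"
  shows "A' = grown_arcs ds A ws"
proof (intro set_eqI)
  fix e :: "vertex \<times> vertex"
  obtain u v where e: "e = (u, v)" by (cases e)
  consider "v \<in> vertex_set ds" | j where "j < length ws" "v = slot ds j"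
    | "v \<notin> vertex_set ds" "\<nexists>j. j < length ws \<and> v = slot ds j" by blast
  then show "e \<in> A' \<longleftrightarrow> e \<in> grown_arcs ds A ws"
  proof cases
    case 1
    then show ?thesis using assms(2) e by (simp only: grown_arcs_old)
  next
    case 2
    then show ?thesis using assms(3) e by (simp only: grown_arcs_slot)
  next
    case 3
    then have "e \<notin> grown_arcs ds A ws" using e by (auto elim: grown_arcs_target)
    moreover have "e \<notin> A'" using 3 assms(1) e by blast
    ultimately show ?thesis by blast
  qed
qed

lemma grouped_first_pos:
  assumes "grouped ws" "j < length ws" "\<not> (0 < j \<and> ws ! j = ws ! (j - 1))"
  shows "first_pos ws (ws ! j) = j"
proof -
  have "j \<le> k" if "k < length ws" "ws ! k = ws ! j" for k
    using that assms unfolding grouped_def by (metis gr_zeroI leI le_zero_eq less_nat_zero_code)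
  then show ?thesis unfolding first_pos_def using assms(2) by (intro Least_equality) auto
qed

lemma first_pos_first:
  assumes "v \<in> set ws"
  shows "\<not> (0 < first_pos ws v \<and> ws ! first_pos ws v = ws ! (first_pos ws v - 1))"
proof
  assume a: "0 < first_pos ws v \<and> ws ! first_pos ws v = ws ! (first_pos ws v - 1)"
  have "first_pos ws v \<le> first_pos ws v - 1"
    using a first_pos_props[OF assms] unfolding first_pos_def by (intro Least_le) auto
  then show False using a by linarith
qed

context
  fixes ds :: "nat list" and A :: "(vertex \<times> vertex) set" and ws :: "vertex list"
  assumes A: "A \<subseteq> vertex_set ds \<times> vertex_set ds" and ws: "set ws \<subseteq> vertex_set ds"
    and grouped: "grouped ws"
begin

text \<open>A picked child \<open>v\<close> is replaced by the slot of its first occurrence; the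
  slots of later repeats hang from the new vertex. Degrees of old vertices are thus
  unchanged.\<close>

lemma grown_children_old:
  assumes u: "u \<in> vertex_set ds"
  shows "bij_betw (\<lambda>v. if v \<in> set ws then slot ds (first_pos ws v) else v)
    {v. (u, v) \<in> A} {v. (u, v) \<in> grown_arcs ds A ws}"
proof (rule bij_betwI')
  let ?f = "\<lambda>v. if v \<in> set ws then slot ds (first_pos ws v) else v"
  have u0: "u \<noteq> slot ds 0" using u by auto
  show "?f v = ?f v' \<longleftrightarrow> v = v'" if "v \<in> {v. (u, v) \<in> A}" "v' \<in> {v. (u, v) \<in> A}" for v v'
  proof -
    have "v \<in> vertex_set ds" "v' \<in> vertex_set ds" using that A by auto
    then show ?thesis using slot_notin first_pos_props(2) by (metis slot_inject)
  qed
  show "?f v \<in> {v. (u, v) \<in> grown_arcs ds A ws}" if "v \<in> {v. (u, v) \<in> A}" for v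
  proof (cases "v \<in> set ws")
    case True
    then show ?thesis
      using that first_pos_props[OF True] first_pos_first[OF True] by (auto simp: grown_arcs_slot)
  next
    case False
    then show ?thesis using that A by (auto simp: grown_arcs_old)
  qed
  show "\<exists>v \<in> {v. (u, v) \<in> A}. y = ?f v" if "y \<in> {v. (u, v) \<in> grown_arcs ds A ws}" for y
  proof -
    have y: "(u, y) \<in> grown_arcs ds A ws" using that by simp
    then show ?thesis
    proof (cases rule: grown_arcs_target)
      case 1
      then show ?thesis using y u0
        by (intro bexI[of _ y]) (auto simp: grown_arcs_old split: if_splits)
    next
      case (2 j)
      then have "\<not> (0 < j \<and> ws ! j = ws ! (j - 1))" "(u, ws ! j) \<in> A"
        using y u0 by (auto simp: grown_arcs_slot split: if_splits)
      then show ?thesis using 2 grouped_first_pos[OF grouped, of j]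
        by (intro bexI[of _ "ws ! j"]) auto
    qed
  qed
qed

lemma new_child_bij:
  "bij_betw (new_child ds ws) {..<length ws} {v. (slot ds 0, v) \<in> grown_arcs ds A ws}"
proof (rule bij_betwI')
  have N: "(slot ds 0, v) \<notin> A" for v using A slot_notin by blast
  have V: "j < length ws \<Longrightarrow> ws ! j \<in> vertex_set ds" for j using ws by auto
  have less: "new_child ds ws i \<noteq> new_child ds ws j" if "i < j" "j < length ws" for i j
  proof
    assume eq: "new_child ds ws i = new_child ds ws j"
    show False
    proof (cases "Suc i < length ws \<and> ws ! Suc i = ws ! i")
      case True
      then show ?thesis using eq that V slot_notin unfolding new_child_def
        by (metis nat.inject nat_neq_iff slot_inject)
    next
      case False
      then have ne: "ws ! Suc i \<noteq> ws ! i" using that by auto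
      have "new_child ds ws i = ws ! i" using False by (auto simp: new_child_def)
      moreover have "ws ! i \<in> vertex_set ds" using that V by auto
      ultimately have j: "ws ! j = ws ! i"
        using eq slot_notin unfolding new_child_def by (metis (no_types))
      \<comment> \<open>Equal entries are adjacent, so the run reaches from \<open>i\<close> to
        \<open>j\<close>; but then \<open>i\<close> is not the end of its run.\<close>
      have "ws ! k = ws ! j" if "i < k" "k \<le> j" for k
        using that(2,1)
      proof (induction k rule: inc_induct)
        case (step n)
        have "ws ! (Suc n - 1) = ws ! Suc n"
          using grouped step \<open>j < length ws\<close> j unfolding grouped_def
          by (metis Suc_leI le_less_trans less_Suc_eq)
        then show ?case using step by simp
      qed simp
      then show ?thesis using ne j \<open>i < j\<close> by (metis Suc_leI lessI)
    qed
  qed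
  show "new_child ds ws i = new_child ds ws j \<longleftrightarrow> i = j" if "i \<in> {..<length ws}" "j \<in> {..<length ws}" for i j
    using that less by (metis lessThan_iff nat_neq_iff)
  show "new_child ds ws j \<in> {v. (slot ds 0, v) \<in> grown_arcs ds A ws}" if "j \<in> {..<length ws}" for j
    using that V[of j] by (auto simp: new_child_def grown_arcs_slot grown_arcs_old)
  show "\<exists>j \<in> {..<length ws}. v = new_child ds ws j"
    if "v \<in> {v. (slot ds 0, v) \<in> grown_arcs ds A ws}" for v
  proof -
    have v: "(slot ds 0, v) \<in> grown_arcs ds A ws" using that by simp
    then show ?thesis
    proof (cases rule: grown_arcs_target)
      case 1
      then have "v \<in> set ws" using v N by (auto simp: grown_arcs_old split: if_splits)
      \<comment> \<open>The last occurrence of \<open>v\<close> is wanted: only there does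
        \<open>new_child\<close> return the entry itself.\<close>
      define P where "P j \<longleftrightarrow> j < length ws \<and> ws ! j = v" for j
      have ex: "\<exists>j. P j" using \<open>v \<in> set ws\<close> by (auto simp: P_def in_set_conv_nth)
      have bd: "P j \<Longrightarrow> j \<le> length ws" for j by (simp add: P_def)
      define j where "j = Greatest P"
      have "P j" unfolding j_def using ex bd by (metis GreatestI_nat)
      moreover have "\<not> P (Suc j)" unfolding j_def
        using bd Greatest_le_nat[of P "Suc (Greatest P)" "length ws"] by auto
      ultimately show ?thesis by (intro bexI[of _ j]) (auto simp: P_def new_child_def)
    next
      case (2 j)
      then have "0 < j \<and> ws ! j = ws ! (j - 1)"
        using v N by (auto simp: grown_arcs_slot split: if_splits)
      then show ?thesis using 2 by (intro bexI[of _ "j - 1"]) (auto simp: new_child_def)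
    qed
  qed
qed

end

lemma grown_labelled:
  assumes T: "T \<in> labelled_trees ds" and ws: "set ws \<subseteq> vertex_set ds" "grouped ws" "ws \<noteq> []"
    and T': "rooted_tree T'" "verts T' = vertex_set (ds @ [length ws])"
      "arcs T' = grown_arcs ds (arcs T) ws"
  shows "T' \<in> labelled_trees (ds @ [length ws])"
proof -
  have A: "arcs T \<subseteq> vertex_set ds \<times> vertex_set ds"
    using labelled_treesD[OF T] unfolding rooted_tree_def by metis
  have ch: "card (children T' u) = card (children T u)" "children T u = {} \<longleftrightarrow> children T' u = {}"
    if "u \<in> vertex_set ds" for u
    using grown_children_old[OF A ws(1,2) that] bij_betw_same_card
    unfolding children_def T'(3) by (fastforce simp: bij_betw_def)+
  have ch0: "card (children T' (slot ds 0)) = length ws"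
    using new_child_bij[OF A ws(1,2)] unfolding children_def T'(3)
    by (metis bij_betw_same_card card_lessThan)
  have "card (children T' (Node i)) = (ds @ [length ws]) ! (i - 1)"
    if i: "i \<in> {1..length (ds @ [length ws])}" for i
  proof (cases "i \<le> length ds")
    case True
    then have "Node i \<in> vertex_set ds" using i unfolding vertex_set_def by auto
    then show ?thesis using ch True i T unfolding labelled_trees_def by (auto simp: nth_append)
  next
    case False
    then have "i = length ds + 1" using i by auto
    then show ?thesis using ch0 by (simp add: slot_def)
  qed
  moreover have "children T' (Leaf i) = {}" if i: "i \<in> {1..num_leaves (ds @ [length ws])}" for i
  proof (cases "i \<le> num_leaves ds")
    case True
    then have "Leaf i \<in> vertex_set ds" using i unfolding vertex_set_def by auto
    then show ?thesis using ch(2) leaf_no_child[OF T] unfolding children_def by auto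
  next
    case False
    then have "Leaf i \<notin> vertex_set ds" unfolding vertex_set_def by auto
    then show ?thesis
      using grown_arcs_source[OF _ A] T'(3) unfolding children_def by (force simp: slot_def)
  qed
  ultimately show ?thesis using T' unfolding labelled_trees_def by auto
qed

text \<open>\<open>grown_children_old\<close> is a bijection of children, so degree conditions pass
  back from the grown to the old tree as well.\<close>

lemma grown_labelled_converse:
  assumes T': "T' \<in> labelled_trees (ds @ [length ws])"
    and ws: "set ws \<subseteq> vertex_set ds" "grouped ws"
    and T: "rooted_tree T" "verts T = vertex_set ds" and arcs: "arcs T' = grown_arcs ds (arcs T) ws"
  shows "T \<in> labelled_trees ds"
proof -
  have A: "arcs T \<subseteq> vertex_set ds \<times> vertex_set ds"
    using T unfolding rooted_tree_def by metis
  have ch: "card (children T' u) = card (children T u)" "children T u = {} \<longleftrightarrow> children T' u = {}"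
    if "u \<in> vertex_set ds" for u
    using grown_children_old[OF A ws(1,2) that] bij_betw_same_card
    unfolding children_def arcs by (fastforce simp: bij_betw_def)+
  have "card (children T (Node i)) = ds ! (i - 1)" if i: "i \<in> {1..length ds}" for i
  proof -
    have "Node i \<in> vertex_set ds" using i unfolding vertex_set_def by auto
    moreover have "i \<in> {1..length (ds @ [length ws])}" "(ds @ [length ws]) ! (i - 1) = ds ! (i - 1)"
      using i by (auto simp: nth_append)
    then have "card (children T' (Node i)) = ds ! (i - 1)"
      using T' unfolding labelled_trees_def by force
    ultimately show ?thesis using ch(1) by simp
  qed
  moreover have "children T (Leaf i) = {}" if i: "i \<in> {1..num_leaves ds}" for i
  proof -
    have "Leaf i \<in> vertex_set ds" using i unfolding vertex_set_def by auto
    then show ?thesis using ch(2) leaf_no_child[OF T'] unfolding children_def by auto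
  qed
  ultimately show ?thesis using T unfolding labelled_trees_def by auto
qed

section \<open>The growth procedure computes the closed form\<close>

context
  fixes ds :: "nat list" and T :: rtree and ws :: "vertex list"
  assumes T: "T \<in> labelled_trees ds" and ge1: "\<forall>i < length ds. ds ! i \<ge> 1"
    and ws: "set ws \<subseteq> vertex_set ds" "ws \<noteq> []" and sorted: "sorted (map (pos ds T) ws)"
begin

lemma pos_nth_mono:
  assumes "i \<le> j" "j < length ws"
  shows "pos ds T (ws ! i) \<le> pos ds T (ws ! j)"
  using sorted_nth_mono[OF sorted, of i j] assms by simp

lemma sorted_grouped: "grouped ws"
  unfolding grouped_def
proof (intro allI impI)
  fix i j assume ij: "i < j" "j < length ws" "ws ! i = ws ! j"
  then have "pos ds T (ws ! (j - 1)) = pos ds T (ws ! j)"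
    using pos_nth_mono[of i "j - 1"] pos_nth_mono[of "j - 1" j] by auto
  moreover have "ws ! (j - 1) \<in> vertex_set ds" "ws ! j \<in> vertex_set ds" using ws ij by auto
  ultimately show "ws ! (j - 1) = ws ! j" using pos_inj[OF T ge1] by blast
qed

lemma grow_eq:
  "grow ds T (mset ws) =
    \<lparr>verts = vertex_set (ds @ [length ws]),
     tree_root = (if ws ! 0 = tree_root T then slot ds 0 else tree_root T),
     arcs = grown_arcs ds (arcs T) ws\<rparr>"
proof -
  note rt = labelled_treesD(1)[OF T] and V = labelled_treesD(2)[OF T]
  have A: "arcs T \<subseteq> vertex_set ds \<times> vertex_set ds"
    using V rt unfolding rooted_tree_def by metis
  have V': "verts T \<union> {Node (length ds + 1)} \<union> Leaf ` {num_leaves ds + 1..num_leaves ds + length ws - 1}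
    = vertex_set (ds @ [length ws])"
  proof -
    have "{1..num_leaves (ds @ [length ws])} =
      {1..num_leaves ds} \<union> {num_leaves ds + 1..num_leaves ds + length ws - 1}"
      using ws(2) by (cases ws) (auto simp: num_leaves_snoc)
    moreover have "{1..length (ds @ [length ws])} = insert (length ds + 1) {1..length ds}" by auto
    ultimately show ?thesis unfolding V vertex_set_def by (simp add: image_Un) blast
  qed
  let ?G = "\<lambda>k. \<lparr>verts = vertex_set (ds @ [length ws]),
     tree_root = (if ws ! 0 = tree_root T then slot ds 0 else tree_root T),
     arcs = grown_arcs ds (arcs T) (take k ws)\<rparr>"
  have par: "parent T' v = u" if "\<And>u'. (u', v) \<in> arcs T' \<longleftrightarrow> (u', v) \<in> arcs T" "(u, v) \<in> arcs T"
    for T' :: rtree and u v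
    unfolding parent_def using that rooted_tree_parent_unique[OF rt] by (intro the_equality) auto
  have root_arc: "(u, tree_root T) \<notin> arcs T" for u using rt unfolding rooted_tree_def by blast
  have w0: "ws ! 0 \<in> vertex_set ds" using ws by auto
  have root_slot: "tree_root T \<noteq> slot ds 0" "slot ds 0 \<noteq> tree_root T"
    using rt V slot_notin unfolding rooted_tree_def by metis+
  have w0_slot: "slot ds 0 \<noteq> ws ! 0" using w0 slot_notin by metis
  have take1: "take 1 ws = [ws ! 0]" using ws(2) by (cases ws) auto
  let ?T0 = "T\<lparr>verts := vertex_set (ds @ [length ws])\<rparr>"
  have first: "grow_first (length ds + 1) (ws ! 0) ?T0 = ?G 1"
  proof (cases "ws ! 0 = tree_root T")
    case True
    have "insert (slot ds 0, ws ! 0) (arcs T) = grown_arcs ds (arcs T) (take 1 ws)"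
      unfolding take1
    proof (rule grown_arcs_eqI)
      show "v \<in> vertex_set ds \<or> (\<exists>j < length [ws ! 0]. v = slot ds j)"
        if "(u, v) \<in> insert (slot ds 0, ws ! 0) (arcs T)" for u v using that A w0 by auto
    qed (use A slot_notin True root_arc root_slot w0 in auto)
    then show ?thesis using True unfolding grow_first_def by (simp add: slot_def)
  next
    case False
    then obtain v where v: "(v, ws ! 0) \<in> arcs T"
      using rooted_tree_parent_ex[OF rt] w0 V by metis
    then have p: "parent ?T0 (ws ! 0) = v" by (intro par) auto
    have "(arcs T - {(v, ws ! 0)}) \<union> {(v, slot ds 0), (slot ds 0, ws ! 0)} =
      grown_arcs ds (arcs T) (take 1 ws)"
      unfolding take1
    proof (rule grown_arcs_eqI)
      show "x \<in> vertex_set ds \<or> (\<exists>j < length [ws ! 0]. x = slot ds j)"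
        if "(u, x) \<in> (arcs T - {(v, ws ! 0)}) \<union> {(v, slot ds 0), (slot ds 0, ws ! 0)}" for u x
        using that A w0 by auto
    qed (use A slot_notin v rooted_tree_parent_unique[OF rt] w0 w0_slot in auto)
    then show ?thesis using False p unfolding grow_first_def by (simp add: slot_def)
  qed
  \<comment> \<open>The loop invariant \<open>?G k\<close> is the closed form for the first
    \<open>k\<close> entries. \<open>grow_next\<close> counts from 1, so step \<open>Suc k\<close>
    treats \<open>ws ! k\<close>.\<close>
  have next_step: "grow_next (length ds + 1) (num_leaves ds) ws (Suc k) (?G k) = ?G (Suc k)"
    if k: "1 \<le> k" "k < length ws" for k
  proof -
    let ?w = "ws ! k"
    have wV: "?w \<in> vertex_set ds" using ws k by auto
    have sl: "Leaf (num_leaves ds + Suc k - 1) = slot ds k" using k by (simp add: slot_def)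
    have idx: "Suc k - 2 = k - 1" "Suc k - 1 = k" by auto
    have N: "Node (length ds + 1) = slot ds 0" by (simp add: slot_def)
    have setS: "set (take (Suc k) ws) = insert ?w (set (take k ws))"
      using k by (simp add: take_Suc_conv_app_nth)
    have nthS: "j < length (take (Suc k) ws) \<longleftrightarrow> j < length (take k ws) \<or> j = k" for j
      using k by auto
    have nth: "take (Suc k) ws ! j = ws ! j" "take (Suc k) ws ! (j - 1) = ws ! (j - 1)"
      if "j < length (take (Suc k) ws)" for j using that by auto
    have nth': "take k ws ! j = ws ! j" "take k ws ! (j - 1) = ws ! (j - 1)"
      if "j < length (take k ws)" for j using that by auto
    show ?thesis
    proof (cases "?w = ws ! (k - 1)")
      case True
      then have mem: "?w \<in> set (take k ws)"
        using k nth_mem[of "k - 1" "take k ws"] by simp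
      have "insert (slot ds 0, slot ds k) (grown_arcs ds (arcs T) (take k ws)) =
        grown_arcs ds (arcs T) (take (Suc k) ws)"
      proof (rule grown_arcs_eqI)
        show "v \<in> vertex_set ds \<or> (\<exists>j < length (take (Suc k) ws). v = slot ds j)"
          if "(u, v) \<in> insert (slot ds 0, slot ds k) (grown_arcs ds (arcs T) (take k ws))" for u v
          using that k nthS by (auto elim!: grown_arcs_target)
        show "(u, v) \<in> insert (slot ds 0, slot ds k) (grown_arcs ds (arcs T) (take k ws)) \<longleftrightarrow>
          (if v \<in> set (take (Suc k) ws) then u = slot ds 0 else (u, v) \<in> arcs T)"
          if "v \<in> vertex_set ds" for u v
        proof -
          have "v \<noteq> slot ds k" using that slot_notin by metis
          then show ?thesis using that setS mem by (simp add: grown_arcs_old insert_absorb)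
        qed
        show "(u, slot ds j) \<in> insert (slot ds 0, slot ds k) (grown_arcs ds (arcs T) (take k ws)) \<longleftrightarrow>
          (if 0 < j \<and> take (Suc k) ws ! j = take (Suc k) ws ! (j - 1) then u = slot ds 0
           else (u, take (Suc k) ws ! j) \<in> arcs T)"
          if j: "j < length (take (Suc k) ws)" for u j
        proof (cases "j = k")
          case jk: True
          have "(u, slot ds k) \<notin> grown_arcs ds (arcs T) (take k ws)"
            by (auto elim!: grown_arcs_target)
          then show ?thesis unfolding nth[OF j] using jk True k by auto
        next
          case False
          then have j': "j < length (take k ws)" using j nthS by blast
          then show ?thesis unfolding nth[OF j]
            using False grown_arcs_slot[OF j', of u ds "arcs T"] unfolding nth'[OF j'] by simp
        qed
      qed
      then show ?thesis using True unfolding grow_next_def Let_def sl idx N by simp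
    next
      case False
      have mem: "?w \<notin> set (take k ws)"
      proof
        assume "?w \<in> set (take k ws)"
        then obtain i where "i < k" "ws ! i = ?w" by (auto simp: in_set_conv_nth)
        then show False using sorted_grouped False k unfolding grouped_def by metis
      qed
      have w0k: "ws ! 0 \<in> set (take k ws)"
        using k nth_mem[of 0 "take k ws"] by simp
      \<comment> \<open>The root is least in the order, so it can be picked only at the front; a
        later new entry therefore has a parent to be detached from.\<close>
      have "?w \<noteq> tree_root T"
      proof
        assume r: "?w = tree_root T"
        have "(tree_root T, ws ! 0) \<in> (arcs T)\<^sup>*" using rt w0 V unfolding rooted_tree_def by blast
        then have "pos ds T ?w \<le> pos ds T (ws ! 0)" using pos_ancestor[OF T ge1] r by simp
        moreover have "pos ds T (ws ! 0) \<le> pos ds T ?w" using pos_nth_mono k by simp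
        ultimately have "ws ! 0 = ?w" using pos_inj[OF T ge1 w0 wV] by simp
        then show False using w0k mem by simp
      qed
      then obtain v where v: "(v, ?w) \<in> arcs T"
        using rooted_tree_parent_ex[OF rt] wV V by metis
      \<comment> \<open>An entry not yet picked still has its original parent, so the lookup in the
        current tree agrees with \<open>T\<close>.\<close>
      have p: "parent (?G k) ?w = v"
        using v mem wV by (intro par) (auto simp: grown_arcs_old)
      have vs: "v \<noteq> slot ds 0" using v A by auto
      have wk_slot: "?w \<noteq> slot ds k" "slot ds k \<noteq> ?w" using wV slot_notin by metis+
      let ?B = "(grown_arcs ds (arcs T) (take k ws) - {(v, ?w)}) \<union> {(v, slot ds k), (slot ds 0, ?w)}"
      have "?B = grown_arcs ds (arcs T) (take (Suc k) ws)"
      proof (rule grown_arcs_eqI)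
        show "x \<in> vertex_set ds \<or> (\<exists>j < length (take (Suc k) ws). x = slot ds j)"
          if ux: "(u, x) \<in> ?B" for u x
        proof -
          consider "(u, x) \<in> grown_arcs ds (arcs T) (take k ws)" | "x = slot ds k" | "x = ?w"
            using ux by blast
          then show ?thesis
          proof cases
            case 1
            then show ?thesis using nthS by (elim grown_arcs_target) blast+
          qed (use wV nthS in blast)+
        qed
        show "(u, x) \<in> ?B \<longleftrightarrow>
          (if x \<in> set (take (Suc k) ws) then u = slot ds 0 else (u, x) \<in> arcs T)"
          if x: "x \<in> vertex_set ds" for u x
        proof (cases "x = ?w")
          case True
          have "(u, ?w) \<in> grown_arcs ds (arcs T) (take k ws) \<longleftrightarrow> (u, ?w) \<in> arcs T"
            using mem wV by (simp add: grown_arcs_old)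
          also have "\<dots> \<longleftrightarrow> u = v" using v rooted_tree_parent_unique[OF rt v] by blast
          finally show ?thesis using True setS vs wk_slot by simp
        next
          case False
          moreover have "x \<noteq> slot ds k" using x by auto
          ultimately show ?thesis using x setS by (auto simp: grown_arcs_old)
        qed
        show "(u, slot ds j) \<in> ?B \<longleftrightarrow>
          (if 0 < j \<and> take (Suc k) ws ! j = take (Suc k) ws ! (j - 1) then u = slot ds 0
           else (u, take (Suc k) ws ! j) \<in> arcs T)"
          if j: "j < length (take (Suc k) ws)" for u j
        proof (cases "j = k")
          case jk: True
          have "(u, slot ds k) \<notin> grown_arcs ds (arcs T) (take k ws)"
            by (auto elim!: grown_arcs_target)
          then have "(u, slot ds k) \<in> ?B \<longleftrightarrow> u = v" using wk_slot by blast
          also have "\<dots> \<longleftrightarrow> (u, ?w) \<in> arcs T"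
            using v rooted_tree_parent_unique[OF rt v] by blast
          finally show ?thesis unfolding nth[OF j] unfolding jk using False by simp
        next
          case jk: False
          then have j': "j < length (take k ws)" using j nthS by blast
          have "slot ds j \<noteq> ?w" using wV slot_notin by metis
          then show ?thesis unfolding nth[OF j]
            using jk grown_arcs_slot[OF j', of u ds "arcs T"] unfolding nth'[OF j'] by simp
        qed
      qed
      then show ?thesis using False p unfolding grow_next_def Let_def sl idx N by simp
    qed
  qed
  have fold: "fold (grow_next (length ds + 1) (num_leaves ds) ws) [2..<k + 1] (?G 1) = ?G k"
    if "1 \<le> k" "k \<le> length ws" for k
    using that
  proof (induction k rule: dec_induct)
    case (step k)
    have "[2..<Suc k + 1] = [2..<k + 1] @ [Suc k]" using step.hyps by auto
    then show ?case using step next_step[of k] by simp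
  qed simp
  have lst: "listing T (num_leaves ds) (mset ws) = ws"
    using listing_eq[OF T ge1 ws(1) sorted] .
  show ?thesis unfolding grow_def Let_def lst size_mset V' first
    using fold[of "length ws"] ws(2) by (cases ws) auto
qed

lemma grow_labelled: "grow ds T (mset ws) \<in> labelled_trees (ds @ [length ws])"
proof (rule grown_labelled[OF T ws(1) sorted_grouped ws(2)])
  note rt = labelled_treesD(1)[OF T] and V = labelled_treesD(2)[OF T]
  have A: "arcs T \<subseteq> vertex_set ds \<times> vertex_set ds"
    using V rt unfolding rooted_tree_def by metis
  have d: "length ws \<ge> 1" "0 < length ws" using ws(2) by (cases ws; simp)+
  have w: "j < length ws \<Longrightarrow> ws ! j \<in> vertex_set ds" for j using ws by auto
  have root: "tree_root T \<in> vertex_set ds" "\<And>u. (u, tree_root T) \<notin> arcs T"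
    using rt V unfolding rooted_tree_def by auto
  have root_first: "ws ! 0 = tree_root T" if j: "j < length ws" "ws ! j = tree_root T" for j
  proof -
    have "ws ! 0 \<in> vertex_set ds" using w d by auto
    then have "(tree_root T, ws ! 0) \<in> (arcs T)\<^sup>*" using rt V unfolding rooted_tree_def by blast
    then have "pos ds T (ws ! j) \<le> pos ds T (ws ! 0)" using pos_ancestor[OF T ge1] j by simp
    moreover have "pos ds T (ws ! 0) \<le> pos ds T (ws ! j)" using pos_nth_mono[of 0 j] j by simp
    ultimately show ?thesis using pos_inj[OF T ge1 _ w[OF j(1)]] w[of 0] d j by simp
  qed
  \<comment> \<open>Hence only slot 0 can be left without a parent by a picked root; every further
    occurrence of the root is a repeat.\<close>
  have root_rep: "ws ! (j - 1) = tree_root T" if j: "0 < j" "j < length ws" "ws ! j = tree_root T" for j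
    using root_first[OF j(2,3)] sorted_grouped j unfolding grouped_def by metis
  define B where "B = Max (pos ds T ` vertex_set ds)"
  have B: "pos ds T v \<le> B" if "v \<in> vertex_set ds" for v unfolding B_def using that by auto
  \<comment> \<open>Old vertices get odd ranks in their order. The new vertex gets the even rank
    just below the first picked vertex, above the parent of that vertex, and the new leaves come
    above everything.\<close>
  define rk where "rk v = (if v \<in> vertex_set ds then 2 * pos ds T v + 1
    else if v = slot ds 0 then 2 * pos ds T (ws ! 0) else 2 * B + 2)" for v
  show "verts (grow ds T (mset ws)) = vertex_set (ds @ [length ws])"
    "arcs (grow ds T (mset ws)) = grown_arcs ds (arcs T) ws" by (simp_all add: grow_eq)
  show "rooted_tree (grow ds T (mset ws))"
  proof (rule rooted_treeI[of _ rk]; unfold grow_eq rtree.simps)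
    show "finite (vertex_set (ds @ [length ws]))" by simp
    show "(if ws ! 0 = tree_root T then slot ds 0 else tree_root T) \<in> vertex_set (ds @ [length ws])"
      using d root by (auto simp: vertex_set_snoc[OF d(1)])
    show "grown_arcs ds (arcs T) ws \<subseteq> vertex_set (ds @ [length ws]) \<times> vertex_set (ds @ [length ws])"
    proof clarify
      fix u v assume uv: "(u, v) \<in> grown_arcs ds (arcs T) ws"
      then have "u \<in> vertex_set ds \<or> u = slot ds 0" using grown_arcs_source[OF _ A] by blast
      then show "u \<in> vertex_set (ds @ [length ws]) \<and> v \<in> vertex_set (ds @ [length ws])"
        using d uv unfolding vertex_set_snoc[OF d(1)] by (auto elim!: grown_arcs_target)
    qed
    show "(u, if ws ! 0 = tree_root T then slot ds 0 else tree_root T) \<notin> grown_arcs ds (arcs T) ws" for u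
    proof (cases "ws ! 0 = tree_root T")
      case True
      then show ?thesis using root d by (simp add: grown_arcs_slot)
    next
      case False
      then have "tree_root T \<notin> set ws" using root_first by (metis in_set_conv_nth)
      then show ?thesis using root False by (simp add: grown_arcs_old)
    qed
    show "\<exists>u. (u, v) \<in> grown_arcs ds (arcs T) ws"
      if v: "v \<in> vertex_set (ds @ [length ws])"
        "v \<noteq> (if ws ! 0 = tree_root T then slot ds 0 else tree_root T)" for v
    proof -
      consider "v \<in> vertex_set ds" | j where "j < length ws" "v = slot ds j"
        using v(1) unfolding vertex_set_snoc[OF d(1)] by auto
      then show ?thesis
      proof cases
        case 1
        show ?thesis
        proof (cases "v \<in> set ws")
          case False
          then have "v \<noteq> tree_root T" using v(2) nth_mem[OF d(2)] by (auto split: if_splits)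
          then obtain u where "(u, v) \<in> arcs T"
            using 1 rooted_tree_parent_ex[OF rt] V by metis
          then show ?thesis using 1 False by (auto simp: grown_arcs_old)
        qed (use 1 in \<open>auto simp: grown_arcs_old\<close>)
      next
        case 2
        show ?thesis
        proof (cases "0 < j \<and> ws ! j = ws ! (j - 1)")
          case False
          have "ws ! j \<noteq> tree_root T" using False 2 v(2) root_rep[of j] by (cases j) auto
          then obtain u where "(u, ws ! j) \<in> arcs T"
            using rooted_tree_parent_ex[OF rt] V w 2 by metis
          then show ?thesis using False 2 by (auto simp: grown_arcs_slot)
        qed (use 2 in \<open>auto simp: grown_arcs_slot\<close>)
      qed
    qed
    show "u = u'" if "(u, v) \<in> grown_arcs ds (arcs T) ws" "(u', v) \<in> grown_arcs ds (arcs T) ws" for u u' v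
      using that(1)
    proof (cases rule: grown_arcs_target)
      case 1
      then show ?thesis using that rooted_tree_parent_unique[OF rt]
        by (auto simp: grown_arcs_old split: if_splits)
    next
      case (2 j)
      then show ?thesis using that rooted_tree_parent_unique[OF rt]
        by (auto simp: grown_arcs_slot split: if_splits)
    qed
    show "rk u < rk v" if "(u, v) \<in> grown_arcs ds (arcs T) ws" for u v
      using that
    proof (cases rule: grown_arcs_target)
      case 1
      show ?thesis
      proof (cases "v \<in> set ws")
        case True
        then obtain j where "j < length ws" "v = ws ! j" by (metis in_set_conv_nth)
        then have "pos ds T (ws ! 0) \<le> pos ds T v" using pos_nth_mono by simp
        then show ?thesis using that 1 True by (simp add: grown_arcs_old rk_def)
      next
        case False
        then have "(u, v) \<in> arcs T" using that 1 by (simp add: grown_arcs_old)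
        then show ?thesis using 1 A pos_arc[OF T ge1] by (auto simp: rk_def)
      qed
    next
      case (2 j)
      show ?thesis
      proof (cases "0 < j \<and> ws ! j = ws ! (j - 1)")
        case True
        then have "u = slot ds 0" using that 2 by (simp add: grown_arcs_slot)
        then show ?thesis using True 2 B[OF w, of 0] d by (auto simp: rk_def)
      next
        case False
        then have u: "(u, ws ! j) \<in> arcs T" using that 2 by (auto simp: grown_arcs_slot)
        then have "u \<in> vertex_set ds" using A by auto
        then show ?thesis using 2 B[of u] pos_arc[OF T ge1 u] by (cases j) (auto simp: rk_def)
      qed
    qed
  qed
qed

end

subsection \<open>Injectivity\<close>

text \<open>Only the grown tree and the set \<open>U\<close> of used pieces enter, never the old
  tree or the list. At the last index \<open>slot ds (Suc j)\<close> is not a vertex, so the leaf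
  alternative decides.\<close>

definition chosen :: "nat list \<Rightarrow> rtree \<Rightarrow> vertex set \<Rightarrow> nat \<Rightarrow> vertex \<Rightarrow> bool" where
  "chosen ds T' U j x \<longleftrightarrow>
     (let R = children T' (slot ds 0) - U in
      x \<in> R \<and>
      ((x, slot ds (Suc j)) \<in> (arcs T')\<^sup>* \<or>
       (\<forall>y \<in> R. (y, slot ds (Suc j)) \<notin> (arcs T')\<^sup>*) \<and>
       (\<exists>l \<in> {1..num_leaves ds}. (x, Leaf l) \<in> (arcs T')\<^sup>* \<and>
          (\<forall>y \<in> R. \<forall>k \<in> {1..<l}. (y, Leaf k) \<notin> (arcs T')\<^sup>*))))"

lemma rooted_tree_child_not_above:
  assumes "rooted_tree T" "(n, x) \<in> arcs T"
  shows "(x, n) \<notin> (arcs T)\<^sup>*"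
  using rooted_tree_acyclic[OF assms(1), of n] assms(2)
  by (meson rtrancl_into_trancl2)

text \<open>Two ancestors of \<open>v\<close> are comparable, and a descent from one child of
  \<open>n\<close> to another would enter the latter through \<open>n\<close>, putting
  \<open>n\<close> below its own child. Hence a slot or leaf lies in at most one piece.\<close>

lemma siblings_antichain:
  assumes T: "rooted_tree T" and "x \<in> children T n" "y \<in> children T n"
    and "(x, v) \<in> (arcs T)\<^sup>*" "(y, v) \<in> (arcs T)\<^sup>*"
  shows "x = y"
proof -
  have *: "x = y" if xy: "x \<in> children T n" "y \<in> children T n" "(x, y) \<in> (arcs T)\<^sup>*" for x y
  proof (rule ccontr)
    assume "x \<noteq> y"
    then obtain z where z: "(x, z) \<in> (arcs T)\<^sup>*" "(z, y) \<in> arcs T"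
      using xy(3) by (metis rtranclE)
    then have "z = n" using rooted_tree_parent_unique[OF T] xy(2) unfolding children_def by blast
    then show False using z xy(1) rooted_tree_child_not_above[OF T] unfolding children_def by blast
  qed
  show ?thesis using rooted_tree_ancestors_comparable[OF T assms(4,5)] * assms(2,3) by metis
qed

lemma chosen_unique:
  assumes T: "rooted_tree T'" and x: "chosen ds T' U j x" and y: "chosen ds T' U j y"
  shows "x = y"
proof -
  let ?A = "(arcs T')\<^sup>*" and ?X = "children T' (slot ds 0)"
  have X: "x \<in> ?X - U" "y \<in> ?X - U" using x y by (auto simp: chosen_def Let_def)
  note anti = siblings_antichain[OF T, of x "slot ds 0" y]
  show ?thesis
  proof (cases "(x, slot ds (Suc j)) \<in> ?A \<or> (y, slot ds (Suc j)) \<in> ?A")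
    case True
    then have "(x, slot ds (Suc j)) \<in> ?A \<and> (y, slot ds (Suc j)) \<in> ?A"
      using x y X unfolding chosen_def Let_def by blast
    then show ?thesis using anti X by blast
  next
    case False
    obtain k where k: "k \<ge> 1" "(x, Leaf k) \<in> ?A" "\<forall>z \<in> ?X - U. \<forall>i \<in> {1..<k}. (z, Leaf i) \<notin> ?A"
      using x False unfolding chosen_def Let_def by auto
    obtain l where l: "l \<ge> 1" "(y, Leaf l) \<in> ?A" "\<forall>z \<in> ?X - U. \<forall>i \<in> {1..<l}. (z, Leaf i) \<notin> ?A"
      using y False unfolding chosen_def Let_def by auto
    have "k = l" using k l X by (metis atLeastLessThan_iff nat_neq_iff)
    then show ?thesis using anti X k l by blast
  qed
qed

lemma slot_no_child:
  assumes "T' \<in> labelled_trees (ds @ [d])" "0 < i" "(slot ds i, v) \<in> (arcs T')\<^sup>*"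
  shows "v = slot ds i"
  using assms(3)
proof (cases rule: converse_rtranclE)
  case (step y)
  then show ?thesis using leaf_no_child[OF assms(1)] assms(2) by (simp add: slot_def)
qed simp

lemma below_vertex:
  assumes "T \<in> labelled_trees ds" "(u, v) \<in> (arcs T)\<^sup>*" "u \<in> vertex_set ds"
  shows "v \<in> vertex_set ds"
  using assms(2,3,1) rooted_tree_arcs_verts labelled_treesD by (metis rtranclE)

lemma Leaf_in_vertex_set [simp]: "Leaf l \<in> vertex_set ds \<longleftrightarrow> l \<in> {1..num_leaves ds}"
  unfolding vertex_set_def by auto

section \<open>Descendants before and after growth\<close>

context
  fixes ds :: "nat list" and ws :: "vertex list" and A :: "(vertex \<times> vertex) set" and T' :: rtree
  assumes T': "T' \<in> labelled_trees (ds @ [length ws])"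
    and A: "A \<subseteq> vertex_set ds \<times> vertex_set ds" and ws: "set ws \<subseteq> vertex_set ds"
    and arcs: "arcs T' = grown_arcs ds A ws"
begin

text \<open>The new vertex is the parent of \<open>x\<close>, so it does not occur below
  \<open>x\<close>; an arc into an old vertex that does not start at the new vertex is an old
  arc.\<close>

lemma below_picked:
  assumes "x \<in> set ws" "(x, v) \<in> (arcs T')\<^sup>*" "v \<in> vertex_set ds"
  shows "(x, v) \<in> A\<^sup>*"
proof -
  note rt = labelled_treesD(1)[OF T']
  have Nx: "(slot ds 0, x) \<in> arcs T'"
    using assms ws unfolding arcs by (auto simp: grown_arcs_old)
  from assms(2) have "v \<in> vertex_set ds \<longrightarrow> (x, v) \<in> A\<^sup>*"
  proof (induction rule: rtrancl_induct)
    case (step y v)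
    show ?case
    proof
      assume v: "v \<in> vertex_set ds"
      have y: "y \<noteq> slot ds 0" using step.hyps(1) rooted_tree_child_not_above[OF rt Nx] by blast
      then have a: "(y, v) \<in> A" using step.hyps(2) v unfolding arcs
        by (auto simp: grown_arcs_old split: if_splits)
      then show "(x, v) \<in> A\<^sup>*" using step.IH A by auto
    qed
  qed simp
  then show ?thesis using assms(3) by blast
qed

text \<open>Growth detaches only picked vertices from their parents, so an old descent survives if
  no vertex strictly below its start is picked.\<close>

lemma above_unpicked:
  assumes "(x, v) \<in> A\<^sup>*" "\<And>w. w \<in> set ws \<Longrightarrow> (x, w) \<in> A\<^sup>+ \<Longrightarrow> (w, v) \<notin> A\<^sup>*"
  shows "(x, v) \<in> (arcs T')\<^sup>*"
  using assms
proof (induction rule: rtrancl_induct)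
  case (step y v)
  have "(x, v) \<in> A\<^sup>+" using step.hyps by auto
  then have "v \<notin> set ws" using step.prems by blast
  then have "(y, v) \<in> arcs T'" using step.hyps A unfolding arcs by (auto simp: grown_arcs_old)
  moreover have "(x, y) \<in> (arcs T')\<^sup>*"
    using step.prems step.hyps by (intro step.IH) (meson rtrancl.rtrancl_into_rtrancl)
  ultimately show ?case by auto
qed simp

end

context
  fixes ds :: "nat list" and T :: rtree and ws :: "vertex list" and T' :: rtree
  assumes T: "T \<in> labelled_trees ds" and ge1: "\<forall>i < length ds. ds ! i \<ge> 1"
    and ws: "set ws \<subseteq> vertex_set ds" "ws \<noteq> []" and sorted: "sorted (map (pos ds T) ws)"
    and T': "T' = grow ds T (mset ws)"
begin

lemma new_child_chosen:
  assumes j: "j < length ws"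
  shows "chosen ds T' (new_child ds ws ` {..<j}) j (new_child ds ws j)"
proof -
  let ?x = "new_child ds ws"
  let ?X = "children T' (slot ds 0)"
  let ?R = "?X - ?x ` {..<j}"
  note rt = labelled_treesD(1)[OF T] and V = labelled_treesD(2)[OF T]
  have A: "arcs T \<subseteq> vertex_set ds \<times> vertex_set ds"
    using V rt unfolding rooted_tree_def by metis
  have lT': "T' \<in> labelled_trees (ds @ [length ws])"
    using grow_labelled[OF T ge1 ws sorted] T' by simp
  note rt' = labelled_treesD(1)[OF lT'] and V' = labelled_treesD(2)[OF lT']
  have arcs: "arcs T' = grown_arcs ds (arcs T) ws"
    using grow_eq[OF T ge1 ws sorted] T' by simp
  have gr: "grouped ws" using sorted_grouped[OF T ge1 ws sorted] .
  have d: "1 \<le> length ws" using ws(2) by (cases ws) auto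
  note posmono = pos_nth_mono[OF T ge1 ws sorted]
  have w: "i < length ws \<Longrightarrow> ws ! i \<in> vertex_set ds" for i using ws by auto
  have bij: "bij_betw ?x {..<length ws} ?X"
    using new_child_bij[OF A ws(1) gr] unfolding children_def arcs .
  have xX: "?x i \<in> ?X" if "i < length ws" for i using bij that unfolding bij_betw_def by auto
  have xinj: "?x i = ?x k \<longleftrightarrow> i = k" if "i < length ws" "k < length ws" for i k
    using bij that unfolding bij_betw_def inj_on_def by auto
  have R: "\<exists>k. j \<le> k \<and> k < length ws \<and> y = ?x k" if "y \<in> ?R" for y
    using that bij unfolding bij_betw_def by (force simp: not_less)
  have R': "?x k \<in> ?R" if "j \<le> k" "k < length ws" for k
    using that xX xinj by auto
  have XV: "y \<in> vertex_set (ds @ [length ws])" if "y \<in> ?X" for y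
    using that rooted_tree_arcs_verts(2)[OF rt'] V' unfolding children_def by blast
  have xV: "?x k = ws ! k" if "?x k \<in> vertex_set ds" for k
    using that by (auto simp: new_child_def split: if_splits)
  have old: "y \<in> vertex_set ds" if yv: "y \<in> ?X" "(y, v) \<in> (arcs T')\<^sup>*" "v \<in> vertex_set ds" for y v
  proof (rule ccontr)
    assume "y \<notin> vertex_set ds"
    then obtain i where i: "y = slot ds i" using XV[OF yv(1)] vertex_set_snoc[OF d] by auto
    have "i \<noteq> 0"
    proof
      assume "i = 0"
      then have "(slot ds 0, slot ds 0) \<in> arcs T'" using yv(1) i unfolding children_def by simp
      then show False using rooted_tree_child_not_above[OF rt'] by blast
    qed
    then have "v = y" using slot_no_child[OF lT'] yv(2) i by auto
    then show False using yv(3) i by simp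
  qed
  have ordered: "i < k" if "i < length ws" "pos ds T (ws ! i) < pos ds T (ws ! k)" for i k
    using posmono[of k i] that by (meson leD not_le)
  \<comment> \<open>For a repeat, slot \<open>i\<close> is itself piece \<open>i - 1\<close>.
    Otherwise it hangs from the old parent of \<open>ws ! i\<close>, and a piece containing that
    parent has its top earlier in the order.\<close>
  have slot_index: "k < i" if k: "k < length ws" and i: "i < length ws"
    and over: "(?x k, slot ds i) \<in> (arcs T')\<^sup>*" for k i
  proof (cases "0 < i \<and> ws ! i = ws ! (i - 1)")
    case True
    then have "?x (i - 1) = slot ds i" using i by (auto simp: new_child_def)
    moreover have "i - 1 < length ws" using i by simp
    ultimately have "?x k = ?x (i - 1)"
      using siblings_antichain[OF rt' xX[OF k] xX[of "i - 1"] over] by simp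
    then have "k = i - 1" using xinj[OF k, of "i - 1"] i by simp
    then show ?thesis using True by simp
  next
    case False
    have ne: "?x k \<noteq> slot ds i"
    proof
      assume "?x k = slot ds i"
      then have "(slot ds 0, slot ds i) \<in> arcs T'" using xX[OF k] unfolding children_def by simp
      then have "(slot ds 0, ws ! i) \<in> arcs T"
        using False i unfolding arcs by (simp add: grown_arcs_slot split: if_splits)
      then show False using A by auto
    qed
    then obtain u where u: "(?x k, u) \<in> (arcs T')\<^sup>*" "(u, slot ds i) \<in> arcs T'"
      using over by (metis rtranclE)
    have uw: "(u, ws ! i) \<in> arcs T"
      using u(2) False i unfolding arcs by (simp add: grown_arcs_slot split: if_splits)
    then have uV: "u \<in> vertex_set ds" using A by auto
    then have "?x k \<in> vertex_set ds" using old[OF xX[OF k] u(1)] by blast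
    then have eq: "?x k = ws ! k" by (rule xV)
    then have "(ws ! k, u) \<in> (arcs T)\<^sup>*"
      using below_picked[OF lT' A ws(1) arcs, of "?x k" u] u(1) uV k by simp
    then have "pos ds T (ws ! k) \<le> pos ds T u" using pos_ancestor[OF T ge1] by blast
    also have "\<dots> < pos ds T (ws ! i)" using pos_arc[OF T ge1 uw] .
    finally show ?thesis using ordered k by blast
  qed
  have xR: "?x j \<in> ?R" using R' j by simp
  show ?thesis
  proof (cases "\<exists>y \<in> ?R. (y, slot ds (Suc j)) \<in> (arcs T')\<^sup>*")
    case True
    then obtain y where y: "y \<in> ?R" "(y, slot ds (Suc j)) \<in> (arcs T')\<^sup>*" by blast
    then have "slot ds (Suc j) \<in> vertex_set (ds @ [length ws])"
      using below_vertex[OF lT'] XV by blast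
    then have "Suc j < length ws" using vertex_set_snoc[OF d] by auto
    moreover obtain k where k: "j \<le> k" "k < length ws" "y = ?x k" using R y by blast
    ultimately have "k = j" using slot_index[of k "Suc j"] y by simp
    then show ?thesis using y k xR by (simp add: chosen_def Let_def)
  next
    case False
    \<comment> \<open>If the child were \<open>slot ds (Suc j)\<close>, it would contain that slot
      trivially.\<close>
    have xj: "?x j = ws ! j" and sj: "Suc j < length ws \<Longrightarrow> ws ! Suc j \<noteq> ws ! j"
      using False xR by (auto simp: new_child_def split: if_splits)
    define P where "P l \<longleftrightarrow> l \<in> {1..num_leaves ds} \<and> (ws ! j, Leaf l) \<in> (arcs T)\<^sup>*" for l
    define l where "l = (LEAST l. P l)"
    have "\<exists>l. P l" using leaf_below[OF T ge1 w[OF j]] unfolding P_def by metis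
    then have "P l" unfolding l_def by (metis LeastI)
    then have l: "l \<in> {1..num_leaves ds}" "(ws ! j, Leaf l) \<in> (arcs T)\<^sup>*" unfolding P_def by auto
    have min: "(ws ! j, Leaf k) \<notin> (arcs T)\<^sup>*" if "k \<in> {1..<l}" for k
    proof -
      have "\<not> P k" using not_less_Least[of k P] that unfolding l_def by auto
      then show ?thesis using that l(1) unfolding P_def by auto
    qed
    have "(ws ! j, Leaf l) \<in> (arcs T')\<^sup>*"
    proof (rule above_unpicked[OF lT' A ws(1) arcs l(2)])
      fix v assume v: "v \<in> set ws" "(ws ! j, v) \<in> (arcs T)\<^sup>+"
      show "(v, Leaf l) \<notin> (arcs T)\<^sup>*"
      proof
        assume vl: "(v, Leaf l) \<in> (arcs T)\<^sup>*"
        obtain i where i: "i < length ws" "v = ws ! i" using v(1) by (metis in_set_conv_nth)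
        have strict: "pos ds T a < pos ds T b" if "(a, b) \<in> (arcs T)\<^sup>+" for a b
          using that by (induction rule: trancl_induct) (use pos_arc[OF T ge1] in force)+
        have "j < i" using ordered[OF j, of i] strict[OF v(2)] i by simp
        then have j1: "Suc j < length ws" using i by simp
        have "ws ! Suc j \<noteq> ws ! j" using sj j1 by blast
        then have lt: "pos ds T (ws ! j) < pos ds T (ws ! Suc j)"
          using posmono[of j "Suc j"] pos_inj[OF T ge1 w[OF j] w[OF j1]] j1 by force
        have le: "pos ds T (ws ! Suc j) \<le> pos ds T v" using posmono[of "Suc j" i] \<open>j < i\<close> i by simp
        \<comment> \<open>Without a leaf up to \<open>l\<close> below it, \<open>ws ! Suc j\<close>
          would come after \<open>v\<close>, which is above leaf \<open>l\<close>. A leaf smaller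
          than \<open>l\<close> would instead place it before \<open>ws ! j\<close>, so
          \<open>k = l\<close> and ancestry decides.\<close>
        obtain k where k: "k \<in> {1..l}" "(ws ! Suc j, Leaf k) \<in> (arcs T)\<^sup>*"
          using pos_smaller_leaf[OF T ge1 l(1) vl w[OF j1]] le by force
        have "k = l"
        proof (rule ccontr)
          assume "k \<noteq> l"
          then have "pos ds T (ws ! Suc j) < pos ds T (ws ! j)"
            using k l min by (intro pos_smaller_leaf[OF T ge1 _ k(2) w[OF j]]) auto
          then show False using lt by simp
        qed
        then have "(ws ! j, ws ! Suc j) \<in> (arcs T)\<^sup>* \<or> (ws ! Suc j, ws ! j) \<in> (arcs T)\<^sup>*"
          using rooted_tree_ancestors_comparable[OF rt l(2)] k(2) by blast
        then have anc: "(ws ! j, ws ! Suc j) \<in> (arcs T)\<^sup>*"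
          using pos_ancestor[OF T ge1] lt by (metis not_le)
        then obtain u where u: "(ws ! j, u) \<in> (arcs T)\<^sup>*" "(u, ws ! Suc j) \<in> arcs T"
          using sj j1 by (metis rtranclE)
        \<comment> \<open>A picked vertex interrupting this descent would have an index strictly
          between \<open>j\<close> and \<open>Suc j\<close>.\<close>
        have "(ws ! j, u) \<in> (arcs T')\<^sup>*"
        proof (rule above_unpicked[OF lT' A ws(1) arcs u(1)])
          fix z assume z: "z \<in> set ws" "(ws ! j, z) \<in> (arcs T)\<^sup>+"
          show "(z, u) \<notin> (arcs T)\<^sup>*"
          proof
            assume zu: "(z, u) \<in> (arcs T)\<^sup>*"
            obtain m where m: "m < length ws" "z = ws ! m" using z(1) by (metis in_set_conv_nth)
            have "(z, ws ! Suc j) \<in> (arcs T)\<^sup>+" using zu u(2) by auto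
            then have "m < Suc j" using ordered[OF m(1)] strict m by blast
            moreover have "j < m" using ordered[OF j] strict[OF z(2)] m by blast
            ultimately show False by simp
          qed
        qed
        moreover have "(u, slot ds (Suc j)) \<in> arcs T'"
          using u(2) sj j1 unfolding arcs by (simp add: grown_arcs_slot)
        ultimately have "(?x j, slot ds (Suc j)) \<in> (arcs T')\<^sup>*" using xj by auto
        then show False using False xR by blast
      qed
    qed
    moreover have "(y, Leaf k) \<notin> (arcs T')\<^sup>*" if y: "y \<in> ?R" and k: "k \<in> {1..<l}" for y k
    proof
      assume yk: "(y, Leaf k) \<in> (arcs T')\<^sup>*"
      obtain i where i: "j \<le> i" "i < length ws" "y = ?x i" using R y by blast
      have kL: "Leaf k \<in> vertex_set ds" using k l(1) by simp
      then have "y \<in> vertex_set ds" using old yk y by blast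
      then have yi: "y = ws ! i" using xV i by blast
      then have "(ws ! i, Leaf k) \<in> (arcs T)\<^sup>*"
        using below_picked[OF lT' A ws(1) arcs _ yk kL] i by simp
      then have "pos ds T (ws ! i) < pos ds T (ws ! j)"
        using k l min by (intro pos_smaller_leaf[OF T ge1 _ _ w[OF j]]) auto
      then show False using posmono[OF i(1,2)] by simp
    qed
    ultimately show ?thesis using False xR xj l(1) unfolding chosen_def Let_def by metis
  qed
qed

end

text \<open>Both inputs produce children obeying \<open>chosen\<close> in the same grown tree, and
  uniqueness of each choice makes the two child sequences agree by induction. The list and then the
  old arcs are read off from them.\<close>

lemma grow_injective:
  assumes ge1: "\<forall>i < length ds. ds ! i \<ge> 1"
    and T: "T \<in> labelled_trees ds" "set vs \<subseteq> vertex_set ds" "vs \<noteq> []" "sorted (map (pos ds T) vs)"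
    and U: "U \<in> labelled_trees ds" "set ws \<subseteq> vertex_set ds" "ws \<noteq> []" "sorted (map (pos ds U) ws)"
    and len: "length vs = length ws" and eq: "grow ds T (mset vs) = grow ds U (mset ws)"
  shows "T = U \<and> vs = ws"
proof -
  let ?T' = "grow ds T (mset vs)"
  have rt': "rooted_tree ?T'"
    using labelled_treesD(1) grow_labelled[OF T(1) ge1 T(2-)] by blast
  have child: "new_child ds vs j = new_child ds ws j" if "j < length ws" for j
    using that
  proof (induction j rule: less_induct)
    case (less j)
    have "new_child ds vs ` {..<j} = new_child ds ws ` {..<j}"
      using less by (intro image_cong) auto
    then show ?case
      using chosen_unique[OF rt'] new_child_chosen[OF T(1) ge1 T(2-) refl, of j]
        new_child_chosen[OF U(1) ge1 U(2-) eq, of j] less.prems len by metis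
  qed
  have vV: "vs ! j \<in> vertex_set ds" and wV: "ws ! j \<in> vertex_set ds" if "j < length ws" for j
    using that T(2) U(2) len by auto
  have "vs ! j = ws ! j" if "j < length ws" for j
    using that
  \<comment> \<open>Backwards, because a child that is a slot says only that \<open>ws ! j\<close>
    equals the next entry.\<close>
  proof (induction "length ws - j" arbitrary: j rule: less_induct)
    case less
    have Suc: "Suc j < length ws \<Longrightarrow> vs ! Suc j = ws ! Suc j" using less by auto
    show ?case
      using child[OF less.prems] Suc vV[OF less.prems] wV[OF less.prems] slot_notin[of ds "Suc j"]
      unfolding new_child_def len by (metis (full_types))
  qed
  then have vs: "vs = ws" using len by (auto intro: nth_equalityI)
  note rT = labelled_treesD[OF T(1)] and rU = labelled_treesD[OF U(1)]
  have A: "arcs T \<subseteq> vertex_set ds \<times> vertex_set ds" "arcs U \<subseteq> vertex_set ds \<times> vertex_set ds"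
    using rT rU unfolding rooted_tree_def by metis+
  have arcs: "grown_arcs ds (arcs T) ws = grown_arcs ds (arcs U) ws"
    using eq grow_eq[OF T(1) ge1 T(2-)] grow_eq[OF U(1) ge1 U(2-)] vs by simp
  have iff: "(u, v) \<in> arcs T \<longleftrightarrow> (u, v) \<in> arcs U" if v: "v \<in> vertex_set ds" for u v
  proof (cases "v \<in> set ws")
    case True
    \<comment> \<open>The slot of the first occurrence remembers the old parent of a picked
      vertex.\<close>
    have "(u, slot ds (first_pos ws v)) \<in> grown_arcs ds (arcs T) ws \<longleftrightarrow> (u, v) \<in> arcs T"
      "(u, slot ds (first_pos ws v)) \<in> grown_arcs ds (arcs U) ws \<longleftrightarrow> (u, v) \<in> arcs U"
      using first_pos_props[OF True] first_pos_first[OF True] by (auto simp: grown_arcs_slot)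
    then show ?thesis using arcs by blast
  next
    case False
    then show ?thesis using arcs grown_arcs_old[OF v, of u "arcs T" ws]
        grown_arcs_old[OF v, of u "arcs U" ws] by simp
  qed
  have "arcs T = arcs U"
  proof (intro set_eqI)
    fix e show "e \<in> arcs T \<longleftrightarrow> e \<in> arcs U"
      using A iff by (cases e) blast
  qed
  then show ?thesis using rooted_tree_eqI[OF rT(1) rU(1)] rT(2) rU(2) vs by simp
qed

subsection \<open>Surjectivity\<close>

context
  fixes ds :: "nat list" and d :: nat and T' :: rtree
  assumes T': "T' \<in> labelled_trees (ds @ [d])" and ge1: "\<forall>i < length ds. ds ! i \<ge> 1"
    and d: "d \<ge> 1"
begin

abbreviation "pieces \<equiv> children T' (slot ds 0)"

lemma card_pieces: "card pieces = d" "finite pieces"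
proof -
  have "length ds + 1 \<in> {1..length (ds @ [d])}" by simp
  then have "card (children T' (Node (length ds + 1))) = (ds @ [d]) ! (length ds + 1 - 1)"
    using T' unfolding labelled_trees_def by blast
  then show "card pieces = d" by (simp add: slot_def)
  then show "finite pieces" using d by (metis card.infinite not_one_le_zero)
qed

lemma piece_vertex: "y \<in> pieces \<Longrightarrow> y \<in> vertex_set (ds @ [d])"
  using rooted_tree_arcs_verts(2) labelled_treesD[OF T'] unfolding children_def by blast

lemma piece_not_above_root: "y \<in> pieces \<Longrightarrow> (y, slot ds 0) \<notin> (arcs T')\<^sup>*"
  using rooted_tree_child_not_above labelled_treesD(1)[OF T'] unfolding children_def by blast

lemma piece_cases:
  assumes y: "y \<in> pieces"
  obtains "y \<in> vertex_set ds" | i where "0 < i" "i < d" "y = slot ds i"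
proof -
  have "y \<noteq> slot ds 0" using piece_not_above_root[OF y] by auto
  then show ?thesis using piece_vertex[OF y] that vertex_set_snoc[OF d] by auto
qed

section \<open>Greedy assignment of pieces to slots\<close>

lemma chosen_pieces:
  assumes "chosen ds T' U j x"
  shows "x \<in> pieces - U"
  using assms by (simp add: chosen_def Let_def)

lemma chosen_slot_used:
  assumes "chosen ds T' U j x" "y \<in> pieces - insert x U"
  shows "(y, slot ds (Suc j)) \<notin> (arcs T')\<^sup>*"
proof
  assume over: "(y, slot ds (Suc j)) \<in> (arcs T')\<^sup>*"
  then have "(x, slot ds (Suc j)) \<in> (arcs T')\<^sup>*"
    using assms unfolding chosen_def Let_def by blast
  then have "x = y"
    using siblings_antichain[OF labelled_treesD(1)[OF T'] _ _ _ over] assms chosen_pieces by blast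
  then show False using assms(2) by simp
qed

text \<open>Fewer slots than pieces remain, so some remaining piece contains an old leaf.\<close>

lemma chosen_ex:
  assumes j: "j < d" and x: "\<And>i. i < j \<Longrightarrow> chosen ds T' (x ` {..<i}) i (x i)"
  shows "\<exists>y. chosen ds T' (x ` {..<j}) j y"
proof (rule ccontr)
  assume none: "\<not> ?thesis"
  let ?R = "pieces - x ` {..<j}"
  have xp: "x i \<in> pieces" if "i < j" for i using chosen_pieces[OF x[OF that]] by blast
  have noslot: "(y, slot ds (Suc j)) \<notin> (arcs T')\<^sup>*" if "y \<in> ?R" for y
    using none that unfolding chosen_def Let_def by blast
  have noleaf: "(y, Leaf l) \<notin> (arcs T')\<^sup>*" if "y \<in> ?R" "l \<in> {1..num_leaves ds}" for y l
  proof
    assume yl: "(y, Leaf l) \<in> (arcs T')\<^sup>*"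
    define P where "P l \<longleftrightarrow> l \<in> {1..num_leaves ds} \<and> (\<exists>y \<in> ?R. (y, Leaf l) \<in> (arcs T')\<^sup>*)" for l
    define m where "m = (LEAST l. P l)"
    have "P l" using yl that unfolding P_def by blast
    then have m: "P m" unfolding m_def by (metis LeastI)
    then obtain z where z: "z \<in> ?R" "(z, Leaf m) \<in> (arcs T')\<^sup>*" unfolding P_def by blast
    have "(y, Leaf k) \<notin> (arcs T')\<^sup>*" if "y \<in> ?R" "k \<in> {1..<m}" for y k
    proof -
      have "\<not> P k" using not_less_Least[of k P] that unfolding m_def by auto
      moreover have "k \<in> {1..num_leaves ds}" using m that unfolding P_def by auto
      ultimately show ?thesis using that unfolding P_def by blast
    qed
    then have "chosen ds T' (x ` {..<j}) j z"
      unfolding chosen_def Let_def using z noslot m unfolding P_def by blast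
    then show False using none by blast
  qed
  \<comment> \<open>Slots 1 to \<open>j\<close> are excluded by the earlier choices and slot
    \<open>Suc j\<close> by \<open>noslot\<close>. At least \<open>d - j\<close> remaining pieces
    would need distinct slots from a smaller set.\<close>
  have "\<exists>i. i \<in> {j + 2..<d} \<and> (y, slot ds i) \<in> (arcs T')\<^sup>*" if y: "y \<in> ?R" for y
  proof -
    have "\<forall>i < length (ds @ [d]). (ds @ [d]) ! i \<ge> 1"
      using ge1 d by (auto simp: nth_append less_Suc_eq)
    moreover have "y \<in> vertex_set (ds @ [d])" using y piece_vertex by blast
    ultimately obtain l where l: "l \<in> {1..num_leaves (ds @ [d])}" "(y, Leaf l) \<in> (arcs T')\<^sup>*"
      using leaf_below[OF T'] by metis
    define i where "i = l - num_leaves ds"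
    have "l > num_leaves ds" using noleaf[OF y] l by force
    then have i: "0 < i" "i < d" "Leaf l = slot ds i"
      using l(1) d by (auto simp: i_def num_leaves_snoc slot_def)
    have "i \<noteq> Suc j" using noslot[OF y] l(2) i by metis
    moreover have "\<not> i \<le> j"
    proof
      assume "i \<le> j"
      then obtain k where k: "i = Suc k" "k < j" using i by (cases i) auto
      have "y \<in> pieces - insert (x k) (x ` {..<k})" using y k by auto
      then show False using chosen_slot_used[OF x[OF k(2)]] l(2) i(3) k by metis
    qed
    ultimately show ?thesis using i l(2) by (intro exI[of _ i]) auto
  qed
  then obtain h where h: "\<And>y. y \<in> ?R \<Longrightarrow> h y \<in> {j + 2..<d} \<and> (y, slot ds (h y)) \<in> (arcs T')\<^sup>*"
    by metis
  have "inj_on h ?R"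
  proof (rule inj_onI)
    fix y z assume yz: "y \<in> ?R" "z \<in> ?R" "h y = h z"
    then have "(y, slot ds (h y)) \<in> (arcs T')\<^sup>*" "(z, slot ds (h y)) \<in> (arcs T')\<^sup>*"
      using h by metis+
    then show "y = z"
      using siblings_antichain[OF labelled_treesD(1)[OF T']] yz by blast
  qed
  then have "card ?R \<le> card {j + 2..<d}"
    using h by (intro card_inj_on_le[of h]) auto
  moreover have "card ?R \<ge> d - card (x ` {..<j})"
    using diff_card_le_card_Diff[of "x ` {..<j}" pieces] card_pieces by simp
  moreover have "card (x ` {..<j}) \<le> j" using card_image_le[of "{..<j}" x] by simp
  ultimately show False using j by simp
qed

lemma chosen_seq_ex:
  obtains x where "\<And>j. j < d \<Longrightarrow> chosen ds T' (x ` {..<j}) j (x j)"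
proof -
  have "\<exists>x. \<forall>j < k. chosen ds T' (x ` {..<j}) j (x j)" if "k \<le> d" for k
    using that
  proof (induction k)
    case (Suc k)
    then obtain x where x: "\<forall>j < k. chosen ds T' (x ` {..<j}) j (x j)" by auto
    then obtain y where y: "chosen ds T' (x ` {..<k}) k y" using chosen_ex[of k x] Suc.prems by auto
    have "chosen ds T' ((x(k := y)) ` {..<j}) j ((x(k := y)) j)" if "j < Suc k" for j
    proof -
      have "(x(k := y)) ` {..<j} = x ` {..<j}" using that by (intro image_cong) auto
      then show ?thesis using x y that by (cases "j = k") auto
    qed
    then show ?case by blast
  qed simp
  then show ?thesis using that by blast
qed

context
  fixes x :: "nat \<Rightarrow> vertex"
  assumes x_chosen: "\<forall>j < d. chosen ds T' (x ` {..<j}) j (x j)"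
begin

lemma x_step: "j < d \<Longrightarrow> chosen ds T' (x ` {..<j}) j (x j)"
  using x_chosen by blast

lemma x_piece: "j < d \<Longrightarrow> x j \<in> pieces"
  using chosen_pieces[OF x_step] by blast

lemma x_inj: "i < d \<Longrightarrow> j < d \<Longrightarrow> x i = x j \<longleftrightarrow> i = j"
proof (induction i j rule: linorder_wlog)
  case (le i j)
  have "x i \<in> x ` {..<j}" if "i \<noteq> j" using le that by auto
  moreover have "x j \<notin> x ` {..<j}" using chosen_pieces[OF x_step] le by blast
  ultimately show ?case by metis
qed auto

lemma x_image: "x ` {..<d} = pieces"
proof (rule card_subset_eq)
  have "inj_on x {..<d}" using x_inj by (auto intro!: inj_onI)
  then show "card (x ` {..<d}) = card pieces" using card_pieces by (simp add: card_image)
qed (use card_pieces x_piece in auto)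

lemma x_over_unique:
  assumes "i < d" "j < d" "(x i, v) \<in> (arcs T')\<^sup>*" "(x j, v) \<in> (arcs T')\<^sup>*"
  shows "i = j"
  using siblings_antichain[OF labelled_treesD(1)[OF T'] x_piece x_piece assms(3,4)] x_inj assms
  by blast

lemma x_over_slot:
  assumes k: "k < d" and over: "(x k, slot ds i) \<in> (arcs T')\<^sup>*"
  shows "k < i"
proof (rule ccontr)
  assume "\<not> k < i"
  moreover have "i \<noteq> 0" using piece_not_above_root[OF x_piece[OF k]] over by metis
  ultimately obtain m where m: "i = Suc m" "m < k" by (cases i) auto
  have "x k \<in> pieces - insert (x m) (x ` {..<m})" using x_piece x_inj k m by auto
  then show False using chosen_slot_used[OF x_step] m k over by (metis less_trans)
qed

lemma x_over_old:
  assumes "k < d" "(x k, v) \<in> (arcs T')\<^sup>*" "v \<in> vertex_set ds"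
  shows "x k \<in> vertex_set ds"
  using x_piece[OF assms(1)]
proof (cases rule: piece_cases)
  case (2 i)
  then show ?thesis using slot_no_child[OF T'] assms by metis
qed

text \<open>A piece that is a new leaf has no descendant but itself, so it can only have been chosen
  through the slot alternative.\<close>

lemma x_new:
  assumes k: "k < d" "x k \<notin> vertex_set ds"
  shows "x k = slot ds (Suc k)" "Suc k < d"
proof -
  obtain i where i: "0 < i" "i < d" "x k = slot ds i" using x_piece[OF k(1)] k(2) by (metis piece_cases)
  have "(x k, slot ds (Suc k)) \<in> (arcs T')\<^sup>* \<or> (\<exists>l \<in> {1..num_leaves ds}. (x k, Leaf l) \<in> (arcs T')\<^sup>*)"
    using x_step[OF k(1)] unfolding chosen_def Let_def by blast
  then have *: "(x k, slot ds (Suc k)) \<in> (arcs T')\<^sup>*" using x_over_old k by (metis Leaf_in_vertex_set)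
  then have "slot ds (Suc k) = x k" using slot_no_child[OF T'] i by metis
  then show "x k = slot ds (Suc k)" "Suc k < d" using i by auto
qed

text \<open>The end of the chain of slots filled by slots that starts at \<open>j\<close>; it
  inverts the run encoding of \<open>new_child\<close>.\<close>

definition next_old :: "nat \<Rightarrow> nat" where
  "next_old j = (LEAST k. j \<le> k \<and> x k \<in> vertex_set ds)"

lemma next_old:
  assumes j: "j < d"
  shows "j \<le> next_old j" "x (next_old j) \<in> vertex_set ds" "next_old j < d"
    and "\<And>k. j \<le> k \<Longrightarrow> x k \<in> vertex_set ds \<Longrightarrow> next_old j \<le> k"
proof -
  \<comment> \<open>The last piece is old: by \<open>x_new\<close> it would otherwise be slot
    \<open>d\<close>, which does not exist.\<close>
  have last: "j \<le> d - 1 \<and> x (d - 1) \<in> vertex_set ds" using x_new(2)[of "d - 1"] j by auto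
  then have "j \<le> next_old j \<and> x (next_old j) \<in> vertex_set ds"
    unfolding next_old_def by (rule LeastI)
  then show "j \<le> next_old j" "x (next_old j) \<in> vertex_set ds" by auto
  show le: "\<And>k. j \<le> k \<Longrightarrow> x k \<in> vertex_set ds \<Longrightarrow> next_old j \<le> k"
    unfolding next_old_def by (rule Least_le) auto
  have "next_old j \<le> d - 1" using le last by blast
  then show "next_old j < d" using j by simp
qed

lemma next_old_self: "j < d \<Longrightarrow> x j \<in> vertex_set ds \<Longrightarrow> next_old j = j"
  using next_old by (meson le_antisym order_refl)

lemma next_old_Suc:
  assumes "j < d" "x j \<notin> vertex_set ds"
  shows "next_old j = next_old (Suc j)"
proof -
  have "Suc j < d" using x_new assms by blast
  moreover have "next_old j \<noteq> j" using next_old(2) assms by metis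
  ultimately show ?thesis using next_old[of j] next_old[of "Suc j"] assms
    by (metis Suc_leD Suc_leI le_antisym le_neq_implies_less)
qed

definition picked :: "vertex list" where "picked = map (\<lambda>j. x (next_old j)) [0..<d]"

lemma length_picked [simp]: "length picked = d" by (simp add: picked_def)

lemma nth_picked [simp]: "j < d \<Longrightarrow> picked ! j = x (next_old j)" by (simp add: picked_def)

lemma set_picked: "set picked = pieces \<inter> vertex_set ds"
proof
  show "set picked \<subseteq> pieces \<inter> vertex_set ds" using next_old x_piece by (auto simp: picked_def)
  show "pieces \<inter> vertex_set ds \<subseteq> set picked"
  proof
    fix v assume v: "v \<in> pieces \<inter> vertex_set ds"
    then obtain k where k: "k < d" "v = x k" using x_image by auto
    then have "picked ! k = v" using next_old_self v by simp
    then show "v \<in> set picked" using k by (metis length_picked nth_mem)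
  qed
qed

lemma picked_repeat:
  assumes "Suc j < d"
  shows "picked ! Suc j = picked ! j \<longleftrightarrow> x j \<notin> vertex_set ds"
proof
  assume "picked ! Suc j = picked ! j"
  then have "next_old (Suc j) = next_old j" using x_inj next_old assms by simp
  then show "x j \<notin> vertex_set ds" using next_old(1)[of "Suc j"] next_old_self[of j] assms by auto
next
  assume "x j \<notin> vertex_set ds"
  then show "picked ! Suc j = picked ! j" using next_old_Suc[of j] assms by simp
qed

lemma grouped_picked: "grouped picked"
  unfolding grouped_def
proof (intro allI impI)
  fix i j assume ij: "i < j" "j < length picked" "picked ! i = picked ! j"
  then have "next_old i = next_old j" using x_inj next_old by simp
  then have "\<not> next_old i \<le> j - 1" using next_old(1)[of j] ij by simp
  then have "x (j - 1) \<notin> vertex_set ds" using next_old(4)[of i "j - 1"] ij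
    by (metis Suc_leI diff_Suc_1 diff_le_mono length_picked less_trans)
  then show "picked ! (j - 1) = picked ! j" using picked_repeat[of "j - 1"] ij by simp
qed

lemma slot_piece_iff:
  assumes "j < d"
  shows "slot ds j \<in> pieces \<longleftrightarrow> 0 < j \<and> picked ! j = picked ! (j - 1)"
proof
  assume s: "slot ds j \<in> pieces"
  then obtain k where k: "k < d" "slot ds j = x k" using x_image by auto
  then have "x k \<notin> vertex_set ds" by (metis slot_notin)
  then show "0 < j \<and> picked ! j = picked ! (j - 1)"
    using x_new[OF k(1)] k picked_repeat[of k] assms by simp
next
  assume a: "0 < j \<and> picked ! j = picked ! (j - 1)"
  then have "x (j - 1) \<notin> vertex_set ds" using picked_repeat[of "j - 1"] assms by simp
  then have "x (j - 1) = slot ds j" using x_new(1)[of "j - 1"] assms a by simp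
  then show "slot ds j \<in> pieces" using x_piece[of "j - 1"] assms by simp
qed

text \<open>Inverse to \<open>grown_arcs\<close>: a picked vertex returns to the place kept by the
  slot of its first occurrence.\<close>

definition pruned_arcs :: "(vertex \<times> vertex) set" where
  "pruned_arcs = {(u, v). v \<in> vertex_set ds \<and>
     (if v \<in> pieces then (u, slot ds (first_pos picked v)) \<in> arcs T' else (u, v) \<in> arcs T')}"

lemma first_pos_slot:
  assumes "v \<in> vertex_set ds" "v \<in> pieces"
  shows "slot ds (first_pos picked v) \<notin> pieces" "first_pos picked v < d"
proof -
  have v: "v \<in> set picked" using assms set_picked by blast
  then show "first_pos picked v < d" using first_pos_props(1) by fastforce
  then show "slot ds (first_pos picked v) \<notin> pieces" using slot_piece_iff first_pos_first[OF v] by blast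
qed

lemma pruned_arcs_subset: "pruned_arcs \<subseteq> vertex_set ds \<times> vertex_set ds"
proof -
  have source: "u \<in> vertex_set ds" if "(u, v) \<in> arcs T'" "v \<notin> pieces" for u v
  proof (rule ccontr)
    assume "u \<notin> vertex_set ds"
    moreover have "u \<in> vertex_set (ds @ [d])"
      using that rooted_tree_arcs_verts(1) labelled_treesD[OF T'] by metis
    ultimately obtain i where i: "u = slot ds i" using vertex_set_snoc[OF d] by auto
    then have "i \<noteq> 0" using that by (intro notI) (simp add: children_def)
    then show False using i that leaf_no_child[OF T'] by (simp add: slot_def)
  qed
  have "u \<in> vertex_set ds" if "(u, v) \<in> pruned_arcs" for u v
  proof (cases "v \<in> pieces")
    case True
    then have "(u, slot ds (first_pos picked v)) \<in> arcs T'" "v \<in> vertex_set ds"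
      using that by (simp_all add: pruned_arcs_def)
    then show ?thesis using source first_pos_slot(1) True by blast
  next
    case False
    then have "(u, v) \<in> arcs T'" using that by (simp add: pruned_arcs_def)
    then show ?thesis using source False by blast
  qed
  moreover have "v \<in> vertex_set ds" if "(u, v) \<in> pruned_arcs" for u v
    using that by (simp add: pruned_arcs_def)
  ultimately show ?thesis by (intro subsetI) (metis SigmaI surj_pair)
qed

lemma grown_pruned: "arcs T' = grown_arcs ds pruned_arcs picked"
proof (rule grown_arcs_eqI)
  note rt = labelled_treesD(1)[OF T']
  show "v \<in> vertex_set ds \<or> (\<exists>j < length picked. v = slot ds j)" if "(u, v) \<in> arcs T'" for u v
    using rooted_tree_arcs_verts(2)[OF rt that] labelled_treesD(2)[OF T'] vertex_set_snoc[OF d] by auto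
  have N: "(u, v) \<in> arcs T' \<longleftrightarrow> u = slot ds 0" if "v \<in> pieces" for u v
    using that rooted_tree_parent_unique[OF rt] unfolding children_def by blast
  show "(u, v) \<in> arcs T' \<longleftrightarrow> (if v \<in> set picked then u = slot ds 0 else (u, v) \<in> pruned_arcs)"
    if "v \<in> vertex_set ds" for u v
    using that N set_picked by (simp add: pruned_arcs_def)
  show "(u, slot ds j) \<in> arcs T' \<longleftrightarrow>
    (if 0 < j \<and> picked ! j = picked ! (j - 1) then u = slot ds 0 else (u, picked ! j) \<in> pruned_arcs)"
    if j: "j < length picked" for u j
  proof (cases "0 < j \<and> picked ! j = picked ! (j - 1)")
    case True
    then show ?thesis using N slot_piece_iff[of j] j by simp
  next
    case False
    then have "first_pos picked (picked ! j) = j" using grouped_first_pos[OF grouped_picked j] by blast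
    moreover have "picked ! j \<in> pieces" "picked ! j \<in> vertex_set ds" using set_picked j nth_mem by blast+
    ultimately show ?thesis using False by (simp only: pruned_arcs_def mem_Collect_eq case_prod_conv if_False) simp
  qed
qed

text \<open>One more than the index of the piece containing \<open>v\<close>, and 0 outside all
  pieces.\<close>

definition piece_index :: "vertex \<Rightarrow> nat" where
  "piece_index v = (LEAST i. \<forall>k < d. (x k, v) \<in> (arcs T')\<^sup>* \<longrightarrow> k < i)"

lemma piece_index_le: "(\<And>k. k < d \<Longrightarrow> (x k, v) \<in> (arcs T')\<^sup>* \<Longrightarrow> k < i) \<Longrightarrow> piece_index v \<le> i"
  unfolding piece_index_def by (intro Least_le) blast

lemma piece_index_gt: "k < d \<Longrightarrow> (x k, v) \<in> (arcs T')\<^sup>* \<Longrightarrow> k < piece_index v"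
  unfolding piece_index_def by (rule LeastI2[of _ d]) auto

text \<open>A re-plugged vertex, top of piece k, goes to a slot of index at most k, and by
  \<open>x_over_slot\<close> that slot lies outside all pieces or in a piece of still smaller index.
  Other arcs stay inside a piece or lie outside all pieces at their source.\<close>

lemma piece_index_arc:
  assumes uv: "(u, v) \<in> pruned_arcs"
  shows "piece_index u \<le> piece_index v" "v \<in> pieces \<Longrightarrow> piece_index u < piece_index v"
proof -
  have *: "piece_index u < piece_index v" if vp: "v \<in> pieces"
  proof -
    have vV: "v \<in> vertex_set ds" and us: "(u, slot ds (first_pos picked v)) \<in> arcs T'"
      using uv vp by (auto simp: pruned_arcs_def)
    obtain k where k: "k < d" "v = x k" using x_image vp by auto
    have "picked ! k = v" using next_old_self k vV by simp
    then have "first_pos picked v \<le> k" using k unfolding first_pos_def by (intro Least_le) auto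
    also have "k < piece_index v" using piece_index_gt k by simp
    finally have "first_pos picked v < piece_index v" .
    moreover have "piece_index u \<le> first_pos picked v"
    proof (rule piece_index_le)
      fix m assume "m < d" "(x m, u) \<in> (arcs T')\<^sup>*"
      then show "m < first_pos picked v" using us x_over_slot by (meson rtrancl.rtrancl_into_rtrancl)
    qed
    ultimately show ?thesis by simp
  qed
  then show "v \<in> pieces \<Longrightarrow> piece_index u < piece_index v" .
  show "piece_index u \<le> piece_index v"
  proof (cases "v \<in> pieces")
    case False
    then have "(u, v) \<in> arcs T'" using uv by (simp add: pruned_arcs_def)
    then show ?thesis using piece_index_gt by (intro piece_index_le) (meson rtrancl.rtrancl_into_rtrancl)
  qed (use * in simp)
qed

lemma piece_index_ancestor:
  assumes "(u, v) \<in> pruned_arcs\<^sup>*"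
  shows "piece_index u \<le> piece_index v"
  using assms by (induction rule: rtrancl_induct) (use piece_index_arc in \<open>auto intro: le_trans\<close>)

text \<open>If \<open>slot ds 0\<close> is the root, the top place falls to the vertex plugged into
  slot 0, which undoes the re-rooting of \<open>grow_first\<close>.\<close>

definition pruned :: rtree where
  "pruned = \<lparr>verts = vertex_set ds,
     tree_root = (if tree_root T' = slot ds 0 then picked ! 0 else tree_root T'),
     arcs = pruned_arcs\<rparr>"

lemma pruned_labelled: "pruned \<in> labelled_trees ds"
proof (rule grown_labelled_converse[of T' ds picked])
  note rt = labelled_treesD(1)[OF T'] and V = labelled_treesD(2)[OF T']
  show "T' \<in> labelled_trees (ds @ [length picked])" using T' by simp
  show "set picked \<subseteq> vertex_set ds" using set_picked by blast
  show "grouped picked" by (rule grouped_picked)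
  show "verts pruned = vertex_set ds" "arcs T' = grown_arcs ds (arcs pruned) picked"
    using grown_pruned by (simp_all add: pruned_def)
  have root: "tree_root T' \<in> vertex_set (ds @ [d])" "\<And>u. (u, tree_root T') \<notin> arcs T'"
    using rt V unfolding rooted_tree_def by auto
  have w0: "picked ! 0 \<in> vertex_set ds" "picked ! 0 \<in> pieces"
    using set_picked d nth_mem[of 0 picked] by auto
  have fp0: "first_pos picked (picked ! 0) = 0" using grouped_first_pos[OF grouped_picked, of 0] d by simp
  have ex: "\<exists>u. (u, v) \<in> arcs T'" if "v \<in> vertex_set (ds @ [d])" "v \<noteq> tree_root T'" for v
    using rooted_tree_parent_ex[OF rt] V that by metis
  have oldroot: "tree_root T' \<in> vertex_set ds" if "tree_root T' \<noteq> slot ds 0"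
  proof (rule ccontr)
    assume "tree_root T' \<notin> vertex_set ds"
    then obtain i where i: "tree_root T' = slot ds i" using root(1) vertex_set_snoc[OF d] by auto
    have "slot ds 0 \<in> verts T'" using V vertex_set_snoc[OF d] d by auto
    then have "(tree_root T', slot ds 0) \<in> (arcs T')\<^sup>*" using rt unfolding rooted_tree_def by blast
    moreover have "0 < i" using i that by (cases i) auto
    ultimately have "slot ds 0 = slot ds i" using slot_no_child[OF T'] i by metis
    then show False using i that by simp
  qed
  have rootp: "tree_root T' \<notin> pieces" using root(2) unfolding children_def by blast
  obtain rk :: "vertex \<Rightarrow> nat" where rk: "\<And>u v. (u, v) \<in> arcs T' \<Longrightarrow> rk u < rk v"
    using rooted_tree_rank[OF rt] by blast
  \<comment> \<open>\<open>M\<close> exceeds the rank of every old vertex, so the sum used below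
    compares lexicographically: re-plugged arcs raise \<open>piece_index\<close>, and the others
    raise \<open>rk\<close> without lowering \<open>piece_index\<close>.\<close>
  define M where "M = Suc (Max (rk ` vertex_set ds))"
  have M: "rk v < M" if "v \<in> vertex_set ds" for v
    unfolding M_def using that by (simp add: le_imp_less_Suc)
  show "rooted_tree pruned"
  proof (rule rooted_treeI[of _ "\<lambda>v. piece_index v * M + rk v"]; unfold pruned_def rtree.simps)
    show "(if tree_root T' = slot ds 0 then picked ! 0 else tree_root T') \<in> vertex_set ds"
      using w0 oldroot by simp
    show "pruned_arcs \<subseteq> vertex_set ds \<times> vertex_set ds" by (rule pruned_arcs_subset)
    show "(u, if tree_root T' = slot ds 0 then picked ! 0 else tree_root T') \<notin> pruned_arcs" for u
      using w0 fp0 root(2)[of u] rootp by (auto simp: pruned_arcs_def)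
    show "\<exists>u. (u, v) \<in> pruned_arcs"
      if v: "v \<in> vertex_set ds" "v \<noteq> (if tree_root T' = slot ds 0 then picked ! 0 else tree_root T')" for v
    proof (cases "v \<in> pieces")
      case True
      let ?s = "slot ds (first_pos picked v)"
      have vw: "v \<in> set picked" using True v set_picked by blast
      have "?s \<noteq> tree_root T'"
      proof
        assume eq: "?s = tree_root T'"
        then have "first_pos picked v = 0" using oldroot by (metis slot_inject slot_notin)
        then have "v = picked ! 0" using first_pos_props(2)[OF vw] by simp
        then show False using v(2) eq \<open>first_pos picked v = 0\<close> by simp
      qed
      moreover have "?s \<in> vertex_set (ds @ [d])"
        using first_pos_slot(2)[OF v(1) True] vertex_set_snoc[OF d] by blast
      ultimately show ?thesis using ex v True by (auto simp: pruned_arcs_def)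
    next
      case False
      then have "v \<noteq> tree_root T'" using v by (auto split: if_splits)
      moreover have "v \<in> vertex_set (ds @ [d])" using v vertex_set_snoc[OF d] by blast
      ultimately show ?thesis using ex v False by (auto simp: pruned_arcs_def)
    qed
    show "u = u'" if "(u, v) \<in> pruned_arcs" "(u', v) \<in> pruned_arcs" for u u' v
      using that rooted_tree_parent_unique[OF rt] by (auto simp: pruned_arcs_def split: if_splits)
    show "piece_index u * M + rk u < piece_index v * M + rk v" if uv: "(u, v) \<in> pruned_arcs" for u v
    proof (cases "v \<in> pieces")
      case True
      have "rk u < M" using M pruned_arcs_subset uv by blast
      then have "piece_index u * M + rk u < Suc (piece_index u) * M" by simp
      also have "\<dots> \<le> piece_index v * M" using piece_index_arc(2)[OF uv True] by (intro mult_le_mono1) simp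
      finally show ?thesis by simp
    next
      case False
      then have "rk u < rk v" using uv rk by (simp add: pruned_arcs_def)
      then show ?thesis using piece_index_arc(1)[OF uv] by (simp add: add_le_less_mono)
    qed
  qed simp
qed

section \<open>Smallest remaining leaves and sortedness of the recovered list\<close>

definition remaining :: "nat \<Rightarrow> nat set" where
  "remaining j = {l \<in> {1..num_leaves ds}. \<exists>k. j \<le> k \<and> k < d \<and> (x k, Leaf l) \<in> (arcs T')\<^sup>*}"

lemma below_x:
  assumes "k < d" "(x k, v) \<in> (arcs T')\<^sup>*" "v \<in> vertex_set ds"
  shows "(x k, v) \<in> pruned_arcs\<^sup>*"
proof (rule below_picked[of T' ds picked])
  show "T' \<in> labelled_trees (ds @ [length picked])" using T' by simp
  show "pruned_arcs \<subseteq> vertex_set ds \<times> vertex_set ds" by (rule pruned_arcs_subset)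
  show "set picked \<subseteq> vertex_set ds" using set_picked by blast
  show "arcs T' = grown_arcs ds pruned_arcs picked" by (rule grown_pruned)
  show "x k \<in> set picked" using set_picked x_over_old[OF assms] x_piece[OF assms(1)] by blast
qed (use assms in auto)

text \<open>Backward induction on \<open>j\<close>. Under the leaf alternative the leaf lies in
  piece j itself. Under the slot alternative \<open>picked ! j\<close> equals or lies above
  \<open>picked ! Suc j\<close> and inherits its smallest leaf, unless piece j holds a smaller
  one.\<close>

lemma min_remaining:
  assumes "j < d"
  shows "\<exists>l \<in> remaining j. (\<forall>l' \<in> remaining j. l \<le> l') \<and> (picked ! j, Leaf l) \<in> pruned_arcs\<^sup>*"
  using assms
proof (induction "d - j" arbitrary: j rule: less_induct)
  case less
  note j = less.prems
  have R: "x k \<in> pieces - x ` {..<j}" if "j \<le> k" "k < d" for k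
    using that x_piece x_inj by auto
  from x_step[OF j] consider
      (slot) "(x j, slot ds (Suc j)) \<in> (arcs T')\<^sup>*"
    | (leaf) l where "l \<in> {1..num_leaves ds}" "(x j, Leaf l) \<in> (arcs T')\<^sup>*"
        "\<And>y k. y \<in> pieces - x ` {..<j} \<Longrightarrow> k \<in> {1..<l} \<Longrightarrow> (y, Leaf k) \<notin> (arcs T')\<^sup>*"
    unfolding chosen_def Let_def by blast
  then show ?case
  proof cases
    case leaf
    have "x j \<in> vertex_set ds" using x_over_old[OF j leaf(2)] leaf(1) by simp
    then have "picked ! j = x j" using next_old_self j by simp
    then have "(picked ! j, Leaf l) \<in> pruned_arcs\<^sup>*" using below_x[OF j leaf(2)] leaf(1) by simp
    moreover have "l \<in> remaining j" using leaf j unfolding remaining_def by blast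
    moreover have "l \<le> l'" if "l' \<in> remaining j" for l'
    proof (rule ccontr)
      assume "\<not> l \<le> l'"
      then have "l' \<in> {1..<l}" using that unfolding remaining_def by auto
      then show False using that leaf(3) R unfolding remaining_def by blast
    qed
    ultimately show ?thesis by blast
  next
    case slot
    have "slot ds (Suc j) \<in> vertex_set (ds @ [d])"
      using below_vertex[OF T' slot] piece_vertex x_piece[OF j] by blast
    then have j1: "Suc j < d" using vertex_set_snoc[OF d] by auto
    obtain l where l: "l \<in> remaining (Suc j)" "\<forall>l' \<in> remaining (Suc j). l \<le> l'"
      "(picked ! Suc j, Leaf l) \<in> pruned_arcs\<^sup>*"
      using less.hyps[OF diff_less_mono2[OF lessI j] j1] by blast
    have rem: "remaining (Suc j) \<subseteq> remaining j" unfolding remaining_def by (blast dest: Suc_leD)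
    show ?thesis
    proof (cases "x j \<in> vertex_set ds")
      case False
      then have "(x j, Leaf l') \<notin> (arcs T')\<^sup>*" if "l' \<in> {1..num_leaves ds}" for l'
        using x_over_old[OF j, of "Leaf l'"] that by auto
      then have "remaining j = remaining (Suc j)"
        unfolding remaining_def by (metis (no_types, lifting) Suc_leD Suc_leI le_neq_implies_less)
      then show ?thesis using l picked_repeat[OF j1] False by auto
    next
      case True
      then have wj: "picked ! j = x j" using next_old_self j by simp
      have "x j \<noteq> slot ds (Suc j)" using True slot_notin by metis
      then obtain u where u: "(x j, u) \<in> (arcs T')\<^sup>*" "(u, slot ds (Suc j)) \<in> arcs T'"
        using slot by (metis rtranclE)
      \<comment> \<open>Slot \<open>Suc j\<close> sits below \<open>u\<close>, and
        \<open>picked ! Suc j\<close> takes over its place.\<close>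
      have "(u, picked ! Suc j) \<in> pruned_arcs"
        using u(2) True picked_repeat[OF j1] j1 grown_arcs_slot[of "Suc j" picked u ds pruned_arcs]
        unfolding grown_pruned[symmetric] by simp
      moreover from this have "(x j, u) \<in> pruned_arcs\<^sup>*"
        using below_x[OF j u(1)] pruned_arcs_subset by blast
      ultimately have anc: "(picked ! j, Leaf l) \<in> pruned_arcs\<^sup>*" using l(3) wj by auto
      show ?thesis
      proof (cases "\<forall>l' \<in> remaining j. l \<le> l'")
        case True
        then show ?thesis using anc l(1) rem by blast
      next
        case False
        define m where "m = (LEAST l. l \<in> remaining j)"
        have m: "m \<in> remaining j" using l(1) rem unfolding m_def by (metis LeastI subsetD)
        have min: "\<forall>l' \<in> remaining j. m \<le> l'" unfolding m_def by (simp add: Least_le)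
        then have "m < l" using False by (meson le_trans not_le)
        then have "m \<notin> remaining (Suc j)" using l(2) by auto
        \<comment> \<open>A leaf lost between stages \<open>j\<close> and \<open>Suc j\<close> lies
          in piece \<open>j\<close>.\<close>
        then have "(x j, Leaf m) \<in> (arcs T')\<^sup>*" "Leaf m \<in> vertex_set ds"
          using m unfolding remaining_def by (auto simp: Suc_le_eq le_less)
        then show ?thesis using below_x[OF j] m min wj by metis
      qed
    qed
  qed
qed

text \<open>\<open>piece_index\<close> does not decrease downwards, so nothing below
  \<open>picked ! j\<close> lies in a piece used before stage \<open>j\<close>. With
  \<open>min_remaining\<close>, the smallest leaf below \<open>picked ! j\<close> is the minimum of
  \<open>remaining j\<close>.\<close>

lemma remaining_below:
  assumes j: "j < d" and l: "l \<in> {1..num_leaves ds}" "(picked ! j, Leaf l) \<in> pruned_arcs\<^sup>*"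
  shows "l \<in> remaining j"
proof (rule ccontr)
  assume "l \<notin> remaining j"
  then have "piece_index (Leaf l) \<le> j"
    using l unfolding remaining_def by (intro piece_index_le) (auto simp: not_le)
  moreover have "next_old j < piece_index (picked ! j)" using piece_index_gt[of "next_old j"] next_old j by simp
  ultimately show False using piece_index_ancestor[OF l(2)] next_old(1)[OF j] by simp
qed

text \<open>The sets \<open>remaining j\<close> shrink, so their minima do not decrease. A strict
  increase is settled by \<open>pos_smaller_leaf\<close>; in a tie the two vertices are comparable,
  and \<open>piece_index\<close> rules out the wrong direction.\<close>

lemma pruned_sorted: "sorted (map (pos ds pruned) picked)"
  unfolding sorted_iff_nth_Suc
proof (intro allI impI)
  note P = pruned_labelled
  have arcs: "arcs pruned = pruned_arcs" by (simp add: pruned_def)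
  fix j assume "Suc j < length (map (pos ds pruned) picked)"
  then have j1: "Suc j < d" by simp
  then have j: "j < d" by simp
  have wV: "picked ! i \<in> vertex_set ds" if "i < d" for i using next_old that by simp
  have "pos ds pruned (picked ! j) \<le> pos ds pruned (picked ! Suc j)"
  proof (cases "picked ! Suc j = picked ! j")
    case False
    then have xj: "x j \<in> vertex_set ds" using picked_repeat[OF j1] by simp
    obtain l where l: "l \<in> remaining j" "\<forall>l' \<in> remaining j. l \<le> l'"
      "(picked ! j, Leaf l) \<in> pruned_arcs\<^sup>*" using min_remaining[OF j] by blast
    obtain m where m: "m \<in> remaining (Suc j)" "\<forall>l' \<in> remaining (Suc j). m \<le> l'"
      "(picked ! Suc j, Leaf m) \<in> pruned_arcs\<^sup>*" using min_remaining[OF j1] by blast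
    have lL: "l \<in> {1..num_leaves ds}" using l(1) unfolding remaining_def by simp
    have "l \<le> m" using m(1) l(2) unfolding remaining_def by (blast dest: Suc_leD)
    show ?thesis
    proof (cases "l = m")
      case True
      have "(picked ! Suc j, picked ! j) \<notin> pruned_arcs\<^sup>*"
      proof
        assume "(picked ! Suc j, picked ! j) \<in> pruned_arcs\<^sup>*"
        then have "piece_index (picked ! Suc j) \<le> piece_index (picked ! j)" by (rule piece_index_ancestor)
        moreover have "next_old (Suc j) < piece_index (picked ! Suc j)"
          using piece_index_gt[of "next_old (Suc j)"] next_old[OF j1] j1 by simp
        \<comment> \<open>\<open>x j\<close> lies in no piece other than its own, while
          \<open>picked ! Suc j\<close> has piece index greater than \<open>Suc j\<close>.\<close>
        moreover have "piece_index (x j) \<le> Suc j"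
          using x_over_unique[OF _ j] by (intro piece_index_le) blast
        ultimately show False using next_old(1)[OF j1] next_old_self[OF j xj] j by simp
      qed
      then have "(picked ! j, picked ! Suc j) \<in> pruned_arcs\<^sup>*"
        using rooted_tree_ancestors_comparable[OF labelled_treesD(1)[OF P]] l(3) m(3) True
        unfolding arcs by blast
      then show ?thesis using pos_ancestor[OF P ge1] arcs by simp
    next
      case False
      have "(picked ! Suc j, Leaf k) \<notin> (arcs pruned)\<^sup>*" if "k \<in> {1..l}" for k
      proof
        assume "(picked ! Suc j, Leaf k) \<in> (arcs pruned)\<^sup>*"
        then have "k \<in> remaining (Suc j)" using remaining_below[OF j1] that lL arcs by auto
        then show False using m(2) that False \<open>l \<le> m\<close> by force
      qed
      then have "pos ds pruned (picked ! j) < pos ds pruned (picked ! Suc j)"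
        using l(3) arcs by (intro pos_smaller_leaf[OF P ge1 lL _ wV[OF j1]]) auto
      then show ?thesis by simp
    qed
  qed simp
  then show "map (pos ds pruned) picked ! j \<le> map (pos ds pruned) picked ! Suc j" using j1 by simp
qed

lemma grow_pruned: "grow ds pruned (mset picked) = T'"
proof -
  have picked: "set picked \<subseteq> vertex_set ds" "picked \<noteq> []" using set_picked d length_picked by (blast, fastforce)
  note g = pruned_labelled ge1 picked pruned_sorted
  show ?thesis
  proof (rule rooted_tree_eqI)
    show "rooted_tree (grow ds pruned (mset picked))"
      using labelled_treesD(1)[OF grow_labelled[OF g]] .
    show "verts (grow ds pruned (mset picked)) = verts T'"
      using labelled_treesD(2)[OF T'] grow_eq[OF g] by simp
    show "arcs (grow ds pruned (mset picked)) = arcs T'"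
      using grow_eq[OF g] grown_pruned by (simp add: pruned_def)
  qed (rule labelled_treesD(1)[OF T'])
qed

end

lemma grow_surjective:
  obtains T ws where "T \<in> labelled_trees ds" "set ws \<subseteq> vertex_set ds" "length ws = d"
    "sorted (map (pos ds T) ws)" "grow ds T (mset ws) = T'"
proof -
  obtain x where x: "\<forall>j < d. chosen ds T' (x ` {..<j}) j (x j)" using chosen_seq_ex by blast
  show ?thesis
    using that[OF pruned_labelled[OF x] _ length_picked[OF x] pruned_sorted[OF x] grow_pruned[OF x]]
      set_picked[OF x] by blast
qed

end

section \<open>From sorted lists to multisets and uniform distributions\<close>

lemma sorted_listing_ex:
  assumes "set_mset W \<subseteq> vertex_set ds"
  obtains ws where "mset ws = W" "set ws \<subseteq> vertex_set ds" "sorted (map (pos ds T) ws)"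
proof -
  obtain vs where vs: "mset vs = W" by (metis ex_mset)
  have "mset (sort_key (pos ds T) vs) = W" using vs by simp
  then show ?thesis using that[of "sort_key (pos ds T) vs"] assms by (metis set_mset_mset sorted_sort_key)
qed

lemma grow_bij:
  assumes ge1: "\<forall>i < length ds. ds ! i \<ge> 1" and d: "d \<ge> 1"
  shows "bij_betw (\<lambda>(T, W). grow ds T W) (labelled_trees ds \<times> vertex_multisets ds d)
    (labelled_trees (ds @ [d]))"
proof (rule bij_betwI')
  have nonempty: "ws \<noteq> []" if "mset ws = W" "size W = d" for ws :: "vertex list" and W
    using that d by auto
  show "(case p of (T, W) \<Rightarrow> grow ds T W) = (case q of (T, W) \<Rightarrow> grow ds T W) \<longleftrightarrow> p = q"
    if p: "p \<in> labelled_trees ds \<times> vertex_multisets ds d"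
      and q: "q \<in> labelled_trees ds \<times> vertex_multisets ds d" for p q
  proof -
    obtain T V U W where pq: "p = (T, V)" "q = (U, W)" by (cases p; cases q)
    have TU: "T \<in> labelled_trees ds" "U \<in> labelled_trees ds"
      and VW: "set_mset V \<subseteq> vertex_set ds" "size V = d" "set_mset W \<subseteq> vertex_set ds" "size W = d"
      using p q pq unfolding vertex_multisets_def by auto
    obtain vs where vs: "mset vs = V" "set vs \<subseteq> vertex_set ds" "sorted (map (pos ds T) vs)"
      using sorted_listing_ex[OF VW(1)] by blast
    obtain ws where ws: "mset ws = W" "set ws \<subseteq> vertex_set ds" "sorted (map (pos ds U) ws)"
      using sorted_listing_ex[OF VW(3)] by blast
    have len: "length vs = length ws" using VW vs ws by (metis size_mset)
    show ?thesis
      using grow_injective[OF ge1 TU(1) vs(2) nonempty[OF vs(1)] vs(3) TU(2) ws(2) nonempty[OF ws(1)] ws(3) len]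
        VW vs(1) ws(1) pq by auto
  qed
  show "(case p of (T, W) \<Rightarrow> grow ds T W) \<in> labelled_trees (ds @ [d])"
    if p: "p \<in> labelled_trees ds \<times> vertex_multisets ds d" for p
  proof -
    obtain T W where TW: "p = (T, W)" "T \<in> labelled_trees ds" "set_mset W \<subseteq> vertex_set ds" "size W = d"
      using p unfolding vertex_multisets_def by auto
    obtain ws where ws: "mset ws = W" "set ws \<subseteq> vertex_set ds" "sorted (map (pos ds T) ws)"
      using sorted_listing_ex[OF TW(3)] by blast
    have "length ws = d" using ws(1) TW(4) by (metis size_mset)
    then show ?thesis
      using grow_labelled[OF TW(2) ge1 ws(2) nonempty[OF ws(1) TW(4)] ws(3)] ws(1) TW(1) by simp
  qed
  show "\<exists>p \<in> labelled_trees ds \<times> vertex_multisets ds d. T' = (case p of (T, W) \<Rightarrow> grow ds T W)"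
    if T': "T' \<in> labelled_trees (ds @ [d])" for T'
  proof -
    obtain T ws where "T \<in> labelled_trees ds" "set ws \<subseteq> vertex_set ds" "length ws = d"
      "grow ds T (mset ws) = T'" using grow_surjective[OF T' ge1 d] by metis
    then show ?thesis
      by (intro bexI[of _ "(T, mset ws)"]) (auto simp: vertex_multisets_def)
  qed
qed

lemma finite_labelled_trees: "finite (labelled_trees ds)"
proof (rule inj_on_finite)
  show "inj_on (\<lambda>T. arcs T) (labelled_trees ds)"
    using rooted_tree_eqI labelled_treesD by (intro inj_onI) metis
  show "(\<lambda>T. arcs T) ` labelled_trees ds \<subseteq> Pow (vertex_set ds \<times> vertex_set ds)"
    using labelled_treesD unfolding rooted_tree_def by fastforce
qed simp

lemma finite_vertex_multisets: "finite (vertex_multisets ds d)"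
proof (rule finite_subset)
  show "vertex_multisets ds d \<subseteq> mset ` {ws. set ws \<subseteq> vertex_set ds \<and> length ws = d}"
    unfolding vertex_multisets_def by (auto simp: image_iff) (metis ex_mset set_mset_mset size_mset)
  show "finite (mset ` {ws. set ws \<subseteq> vertex_set ds \<and> length ws = d})"
    by (simp add: finite_lists_length_eq)
qed

lemma vertex_multisets_nonempty: "vertex_multisets ds d \<noteq> {}"
proof -
  have "replicate_mset d (Leaf 1) \<in> vertex_multisets ds d"
    unfolding vertex_multisets_def by (auto simp: num_leaves_def)
  then show ?thesis by blast
qed

text \<open>Trees are produced by growth itself, starting from the single leaf that belongs to the
  empty sequence. Nonemptiness is required because \<open>pmf_of_set\<close> is meaningful only on
  nonempty finite sets.\<close>

lemma labelled_trees_nonempty: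
  assumes "\<forall>i < length ds. ds ! i \<ge> 1"
  shows "labelled_trees ds \<noteq> {}"
  using assms
proof (induction ds rule: rev_induct)
  case Nil
  have V: "vertex_set [] = {Leaf 1}" by (simp add: vertex_set_def num_leaves_def)
  have "\<lparr>verts = {Leaf 1}, tree_root = Leaf 1, arcs = {}\<rparr> \<in> labelled_trees []"
    unfolding labelled_trees_def rooted_tree_def children_def V by simp
  then show ?case by blast
next
  case (snoc d ds)
  have ge1: "\<forall>i < length ds. ds ! i \<ge> 1"
    using snoc.prems by (metis length_append nth_append trans_less_add1)
  have d: "d \<ge> 1" using snoc.prems by (metis length_append_singleton lessI nth_append_length)
  have "labelled_trees ds \<times> vertex_multisets ds d \<noteq> {}"
    using snoc.IH ge1 vertex_multisets_nonempty by blast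
  then show ?case using bij_betw_imp_surj_on[OF grow_bij[OF ge1 d]] by blast
qed

text \<open>Independence turns two uniform choices into a uniform choice from the product, the form
  in which a bijection can transport it.\<close>

lemma pair_pmf_of_set:
  assumes "finite A" "A \<noteq> {}" "finite B" "B \<noteq> {}"
  shows "pair_pmf (pmf_of_set A) (pmf_of_set B) = pmf_of_set (A \<times> B)"
proof (rule pmf_eqI)
  fix p :: "'a \<times> 'b"
  show "pmf (pair_pmf (pmf_of_set A) (pmf_of_set B)) p = pmf (pmf_of_set (A \<times> B)) p"
    using assms by (cases p) (simp add: pmf_pair card_cartesian_product indicator_def)
qed

theorem mainTheorem1:
  fixes ds :: "nat list" and d :: nat
  assumes "length ds \<ge> 1"
    and "\<forall>i < length ds. ds ! i \<ge> 1"
    and "d \<ge> 1"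
  shows "map_pmf (\<lambda>(T, W). grow ds T W)
           (pair_pmf (pmf_of_set (labelled_trees ds)) (pmf_of_set (vertex_multisets ds d)))
         = pmf_of_set (labelled_trees (ds @ [d]))"
proof -
  note ne = labelled_trees_nonempty[OF assms(2)] vertex_multisets_nonempty[of ds d]
    and fin = finite_labelled_trees[of ds] finite_vertex_multisets[of ds d]
  show ?thesis
    unfolding pair_pmf_of_set[OF fin(1) ne(1) fin(2) ne(2)]
    using ne fin by (intro map_pmf_of_set_bij_betw grow_bij assms) auto
qed

end
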